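(* Let $K,L,M,N$ be non-negative integers with $K\le M+N$ and $N\le K+L$, and let $(l_T,t,r_T;r_B,b,l_B)$ be a sextuple of $01$-words of lengths $(K,L,M;N,K+L-N,M+N-K)$ respectively. If there exists an (ordinary, unoriented) hexagonal fully packed loop configuration (HFPL) of size $(K,L,M,N)$ with boundary $(l_T,t,r_T;r_B,b,l_B)$, then: (1) $|l_T|_0+|t|_0=|r_B|_0+|b|_0$ and $|t|_1+|r_T|_1=|b|_1+|l_B|_1$; (2) $l_T\,t\le b\,r_B$ and $t\,r_T\le l_B\,b$, where juxtaposition denotes concatenation of words; (3) $d(r_B)+d(b)+d(l_B)\ \ge\ d(l_T)+d(t)+d(r_T)+|l_T|_1|t|_0+|t|_1|r_T|_0+|r_B|_0|l_B|_1$.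
   Context: Words. A word is a finite sequence over $\{0,1\}$; $|\omega|_i$ is the number of occurrences of $i$ in $\omega$; $d(\omega)$ is the number of pairs $i<j$ with $\omega_i=1,\omega_j=0$. For words $\omega,\sigma$ of the same length $n$ with the same number of ones, $\omega\le\sigma$ means $|\omega_1\cdots\omega_m|_1\le|\sigma_1\cdots\sigma_m|_1$ for all $1\le m\le n$. Graph. Let $K,L,M,N\ge0$ be integers with $K\le M+N$, $N\le K+L$, and $M+N\ge 1$. $H^{K,L,M,N}$ is the induced subgraph of the square lattice $\mathbb Z^2$ (edges join points at distance 1) on the vertices $(x,y)\in\mathbb Z^2$ with $y\le x$, $y\le K-1$, $y\le -x+2(K+L)$, $y\ge -x-1$, $y\ge -M-N+K$, $y\ge x-2(M+L)-1$. A vertex $(x,y)$ is called odd if $x+y$ is an even integer, and even if $x+y$ is an odd integer (so, for $K\geq 1$, the leftmost vertex of the top row is odd). Put $s=M+N-K$. Distinguished vertices: $\mathcal L_T=\{L_{T,i}=(i-1,i-1):1\le i\le K\}$ (leftmost vertices of the top $K$ rows); $\mathcal T=\{T_i=(K-1+2i,K-1):1\le i\le L\}$ (odd vertices of the top row not in $\mathcal L_T\cup\mathcal R_T$); $\mathcal R_T=\{R_{T,i}=(K+2L+i,K-i):1\le i\le M\}$ (rightmost vertices of the top $M$ rows); $\mathcal L_B=\{L_{B,i}=(i-1,-i):1\le i\le s\}$ (leftmost vertices of the bottom $s$ rows); $\mathcal B=\{B_i=(s-1+2i,-s):1\le i\le K+L-N\}$ (even vertices of the bottom row not in $\mathcal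 L_B\cup\mathcal R_B$); $\mathcal R_B=\{R_{B,i}=(K+M-N+2L+i,\,K-M-N-1+i):1\le i\le N\}$ (rightmost vertices of the bottom $N$ rows). HFPL. An HFPL of size $(K,L,M,N)$ is a spanning subgraph $f$ of $H^{K,L,M,N}$ such that vertices in $\mathcal L_B\cup\mathcal L_T\cup\mathcal R_B\cup\mathcal R_T$ have degree 0 or 1, vertices in $\mathcal T\cup\mathcal B$ have degree 1, all other vertices have degree 2, and no path of $f$ joins two vertices of $\mathcal L_B\cup\mathcal L_T$ or two vertices of $\mathcal R_B\cup\mathcal R_T$. Boundary of an HFPL. The boundary $(l_T,t,r_T;r_B,b,l_B)$ of an HFPL $f$ is given by: $(l_T)_i=1$ if $L_{T,i}$ has degree 1, else 0; $t_i=0$ if $T_i$ is connected by a path of $f$ with a vertex in $\mathcal L_T\cup\mathcal L_B\cup\mathcal B$ or with some $T_h$, $h<i$, else $t_i=1$; $(r_T)_i=0$ if $R_{T,i}$ has degree 1, else 1; $(r_B)_i=1$ if $R_{B,i}$ has degree 1, else 0; $b_i=0$ if $B_i$ is connected by a path of $f$ with a vertex in $\mathcal R_T\cup\mathcal R_B\cup\mathcal T$ or with some $B_j$, $j>i$, else $b_i=1$; $(l_B)_i=0$ if $L_{B,i}$ has degree 1, else 1. *)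

theory Defs
  imports "HOL-Library.Z2"
begin

section \<open>Words\<close>

definition inversions :: "bit list \<Rightarrow> nat" where
  "inversions w = card {(i, j). i < j \<and> j < length w \<and> w ! i = 1 \<and> w ! j = 0}"

text \<open>The order relates only words of equal length with equally many ones; these two conditions
  are part of the relation.\<close>

definition word_le :: "bit list \<Rightarrow> bit list \<Rightarrow> bool" where
  "word_le v w \<longleftrightarrow>
     length v = length w \<and> count_list v 1 = count_list w 1 \<and>
     (\<forall>m. 1 \<le> m \<and> m \<le> length v \<longrightarrow> count_list (take m v) 1 \<le> count_list (take m w) 1)"

section \<open>The hexagonal graph\<close>

type_synonym point = "int \<times> int"

definition hex_verts :: "nat \<Rightarrow> nat \<Rightarrow> nat \<Rightarrow> nat \<Rightarrow> point set" where
  "hex_verts K L M N =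
     {(x, y). y \<le> x \<and> y \<le> int K - 1 \<and> y \<le> - x + 2 * (int K + int L) \<and>
              y \<ge> - x - 1 \<and> y \<ge> - int M - int N + int K \<and> y \<ge> x - 2 * (int M + int L) - 1}"

definition hex_edges :: "nat \<Rightarrow> nat \<Rightarrow> nat \<Rightarrow> nat \<Rightarrow> point set set" where
  "hex_edges K L M N =
     {{u, v} | u v. u \<in> hex_verts K L M N \<and> v \<in> hex_verts K L M N \<and>
                    (fst u - fst v)\<^sup>2 + (snd u - snd v)\<^sup>2 = 1}"

text \<open>All indices of distinguished vertices start at 1. The truncated differences \<open>M + N - K\<close> and
  \<open>K + L - N\<close> used below as index bounds are genuine ones for \<open>K \<le> M + N\<close> and \<open>N \<le> K + L\<close>.\<close>

definition LT_pt :: "nat \<Rightarrow> point" where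
  "LT_pt i = (int i - 1, int i - 1)"

definition T_pt :: "nat \<Rightarrow> nat \<Rightarrow> point" where
  "T_pt K i = (int K - 1 + 2 * int i, int K - 1)"

definition RT_pt :: "nat \<Rightarrow> nat \<Rightarrow> nat \<Rightarrow> point" where
  "RT_pt K L i = (int K + 2 * int L + int i, int K - int i)"

definition LB_pt :: "nat \<Rightarrow> point" where
  "LB_pt i = (int i - 1, - int i)"

definition B_pt :: "nat \<Rightarrow> nat \<Rightarrow> nat \<Rightarrow> nat \<Rightarrow> point" where
  "B_pt K M N i = (let s = int M + int N - int K in (s - 1 + 2 * int i, - s))"

definition RB_pt :: "nat \<Rightarrow> nat \<Rightarrow> nat \<Rightarrow> nat \<Rightarrow> nat \<Rightarrow> point" where
  "RB_pt K L M N i =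
     (int K + int M - int N + 2 * int L + int i, int K - int M - int N - 1 + int i)"

definition LT_set :: "nat \<Rightarrow> point set" where
  "LT_set K = LT_pt ` {1..K}"

definition T_set :: "nat \<Rightarrow> nat \<Rightarrow> point set" where
  "T_set K L = T_pt K ` {1..L}"

definition RT_set :: "nat \<Rightarrow> nat \<Rightarrow> nat \<Rightarrow> point set" where
  "RT_set K L M = RT_pt K L ` {1..M}"

definition LB_set :: "nat \<Rightarrow> nat \<Rightarrow> nat \<Rightarrow> point set" where
  "LB_set K M N = LB_pt ` {1..M + N - K}"

definition B_set :: "nat \<Rightarrow> nat \<Rightarrow> nat \<Rightarrow> nat \<Rightarrow> point set" where
  "B_set K L M N = B_pt K M N ` {1..K + L - N}"

definition RB_set :: "nat \<Rightarrow> nat \<Rightarrow> nat \<Rightarrow> nat \<Rightarrow> point set" where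
  "RB_set K L M N = RB_pt K L M N ` {1..N}"

section \<open>Hexagonal fully packed loop configurations\<close>

text \<open>A spanning subgraph contains every vertex, so it is given by its set of edges; an edge is
  the two-element set of its end points.\<close>

definition degree :: "point set set \<Rightarrow> point \<Rightarrow> nat" where
  "degree f v = card {e \<in> f. v \<in> e}"

definition is_path :: "point set set \<Rightarrow> point list \<Rightarrow> bool" where
  "is_path f p \<longleftrightarrow>
     p \<noteq> [] \<and> distinct p \<and> (\<forall>i. Suc i < length p \<longrightarrow> {p ! i, p ! Suc i} \<in> f)"

definition path_connected :: "point set set \<Rightarrow> point \<Rightarrow> point \<Rightarrow> bool" where
  "path_connected f u v \<longleftrightarrow> (\<exists>p. is_path f p \<and> hd p = u \<and> last p = v)"

definition hfpl :: "nat \<Rightarrow> nat \<Rightarrow> nat \<Rightarrow> nat \<Rightarrow> point set set \<Rightarrow> bool" where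
  "hfpl K L M N f \<longleftrightarrow>
     f \<subseteq> hex_edges K L M N \<and>
     (\<forall>v \<in> LB_set K M N \<union> LT_set K \<union> RB_set K L M N \<union> RT_set K L M. degree f v \<in> {0, 1}) \<and>
     (\<forall>v \<in> T_set K L \<union> B_set K L M N. degree f v = 1) \<and>
     (\<forall>v \<in> hex_verts K L M N -
            (LB_set K M N \<union> LT_set K \<union> RB_set K L M N \<union> RT_set K L M \<union>
             T_set K L \<union> B_set K L M N). degree f v = 2) \<and>
     (\<forall>u \<in> LB_set K M N \<union> LT_set K. \<forall>v \<in> LB_set K M N \<union> LT_set K.
        u \<noteq> v \<longrightarrow> \<not> path_connected f u v) \<and>
     (\<forall>u \<in> RB_set K L M N \<union> RT_set K L M. \<forall>v \<in> RB_set K L M N \<union> RT_set K L M.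
        u \<noteq> v \<longrightarrow> \<not> path_connected f u v)"

section \<open>The boundary\<close>

definition word_lT :: "nat \<Rightarrow> point set set \<Rightarrow> bit list" where
  "word_lT K f = map (\<lambda>i. if degree f (LT_pt i) = 1 then 1 else 0) [1..<Suc K]"

definition word_t :: "nat \<Rightarrow> nat \<Rightarrow> nat \<Rightarrow> nat \<Rightarrow> point set set \<Rightarrow> bit list" where
  "word_t K L M N f =
     map (\<lambda>i. if (\<exists>v \<in> LT_set K \<union> LB_set K M N \<union> B_set K L M N. path_connected f (T_pt K i) v) \<or>
                 (\<exists>h \<in> {1..<i}. path_connected f (T_pt K i) (T_pt K h))
              then 0 else 1) [1..<Suc L]"

definition word_rT :: "nat \<Rightarrow> nat \<Rightarrow> nat \<Rightarrow> point set set \<Rightarrow> bit list" where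
  "word_rT K L M f = map (\<lambda>i. if degree f (RT_pt K L i) = 1 then 0 else 1) [1..<Suc M]"

definition word_rB :: "nat \<Rightarrow> nat \<Rightarrow> nat \<Rightarrow> nat \<Rightarrow> point set set \<Rightarrow> bit list" where
  "word_rB K L M N f = map (\<lambda>i. if degree f (RB_pt K L M N i) = 1 then 1 else 0) [1..<Suc N]"

definition word_b :: "nat \<Rightarrow> nat \<Rightarrow> nat \<Rightarrow> nat \<Rightarrow> point set set \<Rightarrow> bit list" where
  "word_b K L M N f =
     map (\<lambda>i. if (\<exists>v \<in> RT_set K L M \<union> RB_set K L M N \<union> T_set K L.
                    path_connected f (B_pt K M N i) v) \<or>
                 (\<exists>j \<in> {i<..K + L - N}. path_connected f (B_pt K M N i) (B_pt K M N j))
              then 0 else 1) [1..<Suc (K + L - N)]"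

definition word_lB :: "nat \<Rightarrow> nat \<Rightarrow> nat \<Rightarrow> point set set \<Rightarrow> bit list" where
  "word_lB K M N f = map (\<lambda>i. if degree f (LB_pt i) = 1 then 0 else 1) [1..<Suc (M + N - K)]"

definition hfpl_boundary ::
  "nat \<Rightarrow> nat \<Rightarrow> nat \<Rightarrow> nat \<Rightarrow> point set set \<Rightarrow>
     bit list \<times> bit list \<times> bit list \<times> bit list \<times> bit list \<times> bit list" where
  "hfpl_boundary K L M N f =
     (word_lT K f, word_t K L M N f, word_rT K L M f,
      word_rB K L M N f, word_b K L M N f, word_lB K M N f)"

end

theory Submission
  imports Defs
begin

text \<open>Orient every path of the configuration, from left to right if its ends allow it and from bottom
  to top otherwise, and every cycle arbitrarily. The edges from odd to even vertices (blue) and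
  those from even to odd vertices (red) then form two disjoint matchings, and the boundary words
  record which distinguished vertices each of them covers. Superimposing the blue matching with the
  reference matching of every odd vertex with its right neighbour gives disjoint lattice paths
  running rightwards from the zeros of \<open>l\<^sub>T t\<close> to the zeros of \<open>b r\<^sub>B\<close> along which \<open>x + y\<close> does not
  decrease; this gives (1) and (2), and \<open>d(b r\<^sub>B) - d(l\<^sub>T t)\<close> counts the steps that increase \<open>x + y\<close>.
  The reflection \<open>(x, y) \<mapsto> (x, -1 - y)\<close> treats the red matching in the same way. If a blue and a
  red path have columns in common, then over these the red one begins below and ends above the blue
  one; as the matchings are disjoint, the two paths share a horizontal edge, which is an increasing
  step of one of them. Counting the pairs of paths that meet a common column gives (3).\<close>

section \<open>Words\<close>

text \<open>The lattice paths are never built. For a weight \<open>g\<close>, comparing the matching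
  with the reference matching (\<open>matching_sum\<close>) leaves only values at the ends of paths;
  suitable \<open>g\<close> give equal numbers of starts and ends, prefix inequalities, index sums
  and the number of paths across a gap between columns. A matching edge followed by a reference edge
  never moves left, so the only closed paths are edges in both matchings, and every other path
  crosses each gap from its start to its end once. A pair of paths with common gaps is represented
  by its last one, where red is not below blue because sinks are lowest in their columns. In place
  of an intermediate value argument, \<open>prev\<close> (one gap to the left) injects the pairs
  with red strictly above into the pairs with red level or above that are not at their last gap; so
  pairs of paths with a common gap are at most as many as level positions. Of all blue-red pairs,
  those without a common gap are counted by \<open>d(t)\<close> and by the pairs 0 before 1 in
  \<open>b\<close>. This is the source of the product \<open>|r_B|_0 |l_B|_1\<close> in (3).\<close>

definition zeros :: "bit list \<Rightarrow> nat set" where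
  "zeros w = {i. i < length w \<and> w ! i = 0}"

definition ones :: "bit list \<Rightarrow> nat set" where
  "ones w = {i. i < length w \<and> w ! i = 1}"

lemma finite_zeros [simp]: "finite (zeros w)" and finite_ones [simp]: "finite (ones w)"
  by (auto simp: zeros_def ones_def)

lemma zeros_Nil [simp]: "zeros [] = {}" and ones_Nil [simp]: "ones [] = {}"
  by (auto simp: zeros_def ones_def)

lemma zeros_snoc: "zeros (w @ [c]) = zeros w \<union> (if c = 0 then {length w} else {})"
  and ones_snoc: "ones (w @ [c]) = ones w \<union> (if c = 1 then {length w} else {})"
  by (auto simp: zeros_def ones_def nth_append less_Suc_eq split: if_splits)

lemma card_zeros: "card (zeros w) = count_list w 0"
proof (induction w rule: rev_induct)
  case (snoc c w)
  have "length w \<notin> zeros w" by (simp add: zeros_def)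
  with snoc show ?case by (auto simp: zeros_snoc)
qed simp

lemma card_ones: "card (ones w) = count_list w 1"
proof (induction w rule: rev_induct)
  case (snoc c w)
  have "length w \<notin> ones w" by (simp add: ones_def)
  with snoc show ?case by (auto simp: ones_snoc)
qed simp

lemma count_zero_plus_one: "count_list w (0::bit) + count_list w 1 = length w"
proof (induction w)
  case (Cons c w) then show ?case by (cases c) auto
qed simp

lemma zeros_take: "zeros (take m w) = {i \<in> zeros w. i < m}"
  by (auto simp: zeros_def)

lemma sum_zeros_ones: "\<Sum>(zeros w) + \<Sum>(ones w) = \<Sum>{..<length w}"
proof -
  have "zeros w \<union> ones w = {..<length w}" "zeros w \<inter> ones w = {}"
    by (auto simp: zeros_def ones_def bit_not_one_iff)
  then show ?thesis by (metis finite_ones finite_zeros sum.union_disjoint)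
qed

lemma finite_index_pairs: "finite {(i::nat, j). i < j \<and> j < n \<and> P i j}"
  by (rule finite_subset[of _ "{..<n} \<times> {..<n}"]) auto

lemma inversions_snoc:
  "inversions (w @ [c]) = inversions w + (if c = 0 then count_list w 1 else 0)"
proof -
  let ?A = "{(i, j). i < j \<and> j < length w \<and> w ! i = 1 \<and> w ! j = 0}"
  let ?B = "if c = 0 then ones w \<times> {length w} else {}"
  have "{(i, j). i < j \<and> j < length (w @ [c]) \<and> (w @ [c]) ! i = 1 \<and> (w @ [c]) ! j = 0} = ?A \<union> ?B"
    by (auto simp: nth_append less_Suc_eq ones_def split: if_splits)
  moreover have "?A \<inter> ?B = {}" "finite ?A" "finite ?B"
    using finite_index_pairs[of "length w" "\<lambda>i j. w ! i = 1 \<and> w ! j = 0"] by auto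
  ultimately show ?thesis
    unfolding inversions_def by (simp add: card_Un_disjoint card_ones)
qed

lemma inversions_Nil [simp]: "inversions [] = 0"
  by (simp add: inversions_def)

lemma inversions_append:
  "inversions (v @ w) = inversions v + inversions w + count_list v 1 * count_list w 0"
proof (induction w rule: rev_induct)
  case (snoc c w)
  have "inversions (v @ w @ [c]) = inversions (v @ w) + (if c = 0 then count_list (v @ w) 1 else 0)"
    using inversions_snoc[of "v @ w" c] by simp
  with snoc show ?case by (simp add: inversions_snoc algebra_simps)
qed simp

text \<open>A zero at index \<open>j\<close> (from 0) with \<open>k\<close> zeros before it is
  preceded by \<open>j - k\<close> ones; over all zeros the \<open>k\<close> run through 0, 1, ...,
  whence the triangular term. Differences of index sums thus become differences of
  inversions.\<close>

lemma inversions_plus_triangle: "inversions w + \<Sum>{..<count_list w 0} = \<Sum>(zeros w)"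
proof (induction w rule: rev_induct)
  case (snoc c w)
  have "length w \<notin> zeros w" by (simp add: zeros_def)
  with snoc count_zero_plus_one[of w] show ?case
    by (simp add: zeros_snoc inversions_snoc lessThan_Suc)
qed simp

text \<open>Needed for \<open>b\<close>, whose zeros are ends of blue paths and whose ones are
  starts of red paths: there the pairs with the zero first have to be counted.\<close>

lemma inversions_compl:
  "card {(j, i). j < i \<and> j \<in> zeros w \<and> i \<in> ones w} + inversions w
     = count_list w 0 * count_list w 1"
proof -
  let ?A = "{(j, i). j < i \<and> j \<in> zeros w \<and> i \<in> ones w}"
  let ?B = "{(j, i). i < j \<and> j \<in> zeros w \<and> i \<in> ones w}"
  have "zeros w \<times> ones w = ?A \<union> ?B" and "?A \<inter> ?B = {}"
    by (auto simp: zeros_def ones_def) (metis linorder_neqE_nat zero_neq_one)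
  moreover have "finite (zeros w \<times> ones w)" by simp
  ultimately have "card (zeros w \<times> ones w) = card ?A + card ?B"
    using card_Un_disjoint[of ?A ?B] by (simp only: finite_Un)
  moreover have "?B = prod.swap ` {(i, j). i < j \<and> j < length w \<and> w ! i = 1 \<and> w ! j = 0}"
    by (auto simp: zeros_def ones_def image_iff)
  hence "card ?B = inversions w"
    by (simp add: inversions_def card_image)
  ultimately show ?thesis by (simp add: card_cartesian_product card_zeros card_ones)
qed

lemma ones_take: "ones (take m w) = {i \<in> ones w. i < m}"
  by (auto simp: ones_def)

lemma word_leI_ones:
  assumes "length v = length w" "count_list v 1 = count_list w 1"
    and "\<And>m. card {i \<in> ones v. i < m} \<le> card {i \<in> ones w. i < m}"
  shows "word_le v w"
  using assms by (simp add: word_le_def card_ones[symmetric] ones_take)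

lemma word_leI_zeros:
  assumes "length v = length w" "count_list v 0 = count_list w 0"
    and "\<And>m. card {i \<in> zeros w. i < m} \<le> card {i \<in> zeros v. i < m}"
  shows "word_le v w"
proof -
  have "count_list (take m v) 1 \<le> count_list (take m w) 1" for m
    using assms(3)[of m] count_zero_plus_one[of "take m v"] count_zero_plus_one[of "take m w"]
      card_zeros[of "take m v"] card_zeros[of "take m w"] assms(1)
    by (simp add: zeros_take)
  moreover have "count_list v 1 = count_list w 1"
    using assms count_zero_plus_one[of v] count_zero_plus_one[of w] by simp
  ultimately show ?thesis using assms by (simp add: word_le_def)
qed

section \<open>Paths and orientations\<close>

lemma path_connected_sym:
  assumes "path_connected f u v" shows "path_connected f v u"
proof -
  obtain p where p: "is_path f p" "hd p = u" "last p = v"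
    using assms by (auto simp: path_connected_def)
  have "{rev p ! i, rev p ! Suc i} \<in> f" if "Suc i < length p" for i
  proof -
    have "{p ! (length p - Suc (Suc i)), p ! Suc (length p - Suc (Suc i))} \<in> f"
      using p that by (auto simp: is_path_def)
    moreover have "Suc (length p - Suc (Suc i)) = length p - Suc i" using that by simp
    ultimately show ?thesis using that by (simp add: rev_nth insert_commute)
  qed
  then have "is_path f (rev p)" using p by (auto simp: is_path_def)
  moreover have "hd (rev p) = v" "last (rev p) = u"
    using p by (auto simp: hd_rev last_rev)
  ultimately show ?thesis by (auto simp: path_connected_def)
qed

lemma path_connected_mono:
  "path_connected f u v \<Longrightarrow> f \<subseteq> g \<Longrightarrow> path_connected g u v"
  by (auto simp: path_connected_def is_path_def)

lemma path_connected_edge: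
  "{u, v} \<in> f \<Longrightarrow> u \<noteq> v \<Longrightarrow> path_connected f u v"
  unfolding path_connected_def by (rule exI[of _ "[u, v]"]) (auto simp: is_path_def)

lemma degree_gt_1:
  assumes "finite f" "{v, a} \<in> f" "{v, b} \<in> f" "a \<noteq> b" shows "degree f v \<ge> 2"
proof -
  have "card {{v, a}, {v, b}} = 2" using assms(4) by (auto simp: card_2_iff doubleton_eq_iff)
  moreover have "card {{v, a}, {v, b}} \<le> degree f v"
    unfolding degree_def using assms by (intro card_mono) auto
  ultimately show ?thesis by simp
qed

lemma degree_gt_2:
  assumes "finite f" "{v, a} \<in> f" "{v, b} \<in> f" "{v, c} \<in> f" "a \<noteq> b" "a \<noteq> c" "b \<noteq> c"
  shows "degree f v \<ge> 3"
proof -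
  have "card {{v, a}, {v, b}, {v, c}} = 3" using assms(5-)
    by (auto simp: card_3_iff doubleton_eq_iff)
  moreover have "card {{v, a}, {v, b}, {v, c}} \<le> degree f v"
    unfolding degree_def using assms by (intro card_mono) auto
  ultimately show ?thesis by simp
qed

text \<open>Degree 1 at the start fixes the first edge; afterwards degree at most 2 fixes each next
  edge, since the edge just used is excluded.\<close>

lemma is_path_unique:
  assumes fin: "finite f" and deg: "\<And>v. degree f v \<le> 2"
    and p: "is_path f p" and q: "is_path f q" and hd: "hd p = hd q" and u: "degree f (hd p) = 1"
  shows "i < length p \<Longrightarrow> i < length q \<Longrightarrow> p ! i = q ! i"
proof (induction i rule: less_induct)
  case (less i)
  have ne: "p \<noteq> []" "q \<noteq> []" using p q by (auto simp: is_path_def)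
  show ?case
  proof (cases i)
    case 0 then show ?thesis using hd ne by (simp add: hd_conv_nth)
  next
    case (Suc j)
    have j: "p ! j = q ! j" using less Suc by auto
    have e: "{p ! j, p ! i} \<in> f" "{p ! j, q ! i} \<in> f"
      using p q less.prems Suc j by (auto simp: is_path_def)
    show ?thesis
    proof (rule ccontr)
      assume ne': "p ! i \<noteq> q ! i"
      show False
      proof (cases j)
        case 0
        with degree_gt_1[OF fin e ne'] u ne show False by (simp add: hd_conv_nth)
      next
        case (Suc k)
        have k: "p ! k = q ! k" using less Suc \<open>i = Suc j\<close> by auto
        have "{p ! j, p ! k} \<in> f"
          using p less.prems Suc \<open>i = Suc j\<close> by (auto simp: is_path_def insert_commute)
        moreover have "p ! k \<noteq> p ! i" "p ! k \<noteq> q ! i"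
          using p q k less.prems Suc \<open>i = Suc j\<close> by (auto simp: is_path_def nth_eq_iff_index_eq)
        ultimately have "degree f (p ! j) \<ge> 3"
          using degree_gt_2[OF fin _ e] ne' by blast
        with deg[of "p ! j"] show False by simp
      qed
    qed
  qed
qed

text \<open>Otherwise \<open>p\<close> would be a proper initial segment of \<open>q\<close> and its
  last vertex an inner vertex of \<open>q\<close>, hence of degree at least 2. The condition
  \<open>last p \<noteq> hd p\<close> provides the edge by which \<open>q\<close> enters that
  vertex.\<close>

lemma path_end_unique_aux:
  assumes fin: "finite f" and deg: "\<And>v. degree f v \<le> 2"
    and p: "is_path f p" and q: "is_path f q" and hd: "hd p = hd q" and u: "degree f (hd p) = 1"
    and v: "degree f (last p) = 1" "last p \<noteq> hd p" and le: "length p \<le> length q"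
  shows "last p = last q"
proof (rule ccontr)
  assume ne: "last p \<noteq> last q"
  have nem: "p \<noteq> []" "q \<noteq> []" using p q by (auto simp: is_path_def)
  define n where "n = length p - 1"
  have n: "length p = Suc n" using nem by (simp add: n_def)
  have pn: "last p = p ! n" using nem n by (simp add: last_conv_nth)
  have qn: "p ! n = q ! n" using is_path_unique[OF fin deg p q hd u, of n] le n by simp
  have "length q \<noteq> Suc n"
    using ne pn qn nem by (metis last_conv_nth diff_Suc_1)
  then have lq: "Suc n < length q" using le n by simp
  have "n \<noteq> 0" using v(2) pn nem by (metis hd_conv_nth)
  then obtain m where m: "n = Suc m" by (cases n) auto
  have "{q ! n, q ! Suc n} \<in> f" "{q ! n, q ! m} \<in> f"
    using q lq m by (auto simp: is_path_def insert_commute)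
  moreover have "q ! Suc n \<noteq> q ! m" using q lq m by (auto simp: is_path_def nth_eq_iff_index_eq)
  ultimately have "degree f (q ! n) \<ge> 2" using degree_gt_1[OF fin] by blast
  then show False using v pn qn by simp
qed

lemma path_end_unique:
  assumes fin: "finite f" and deg: "\<And>v. degree f v \<le> 2"
    and "path_connected f u v" "path_connected f u w"
    and d: "degree f u = 1" "degree f v = 1" "degree f w = 1" "v \<noteq> u" "w \<noteq> u"
  shows "v = w"
proof -
  obtain p q where p: "is_path f p" "hd p = u" "last p = v"
    and q: "is_path f q" "hd q = u" "last q = w"
    using assms by (auto simp: path_connected_def)
  show ?thesis
  proof (cases "length p \<le> length q")
    case True
    then show ?thesis using path_end_unique_aux[OF fin deg p(1) q(1)] p q d by simp
  next
    case False
    then show ?thesis using path_end_unique_aux[OF fin deg q(1) p(1)] p q d by simp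
  qed
qed

section \<open>Balanced orientations of graphs of maximum degree 2\<close>

definition orientation :: "point set set \<Rightarrow> (point \<times> point) set \<Rightarrow> bool" where
  "orientation f D \<longleftrightarrow>
     (\<forall>u v. (u, v) \<in> D \<longrightarrow> {u, v} \<in> f \<and> (v, u) \<notin> D) \<and>
     (\<forall>u v. {u, v} \<in> f \<longrightarrow> (u, v) \<in> D \<or> (v, u) \<in> D)"

lemma orientationD:
  assumes "orientation f D"
  shows "(u, v) \<in> D \<Longrightarrow> {u, v} \<in> f" "(u, v) \<in> D \<Longrightarrow> (v, u) \<notin> D"
    "{u, v} \<in> f \<Longrightarrow> (u, v) \<in> D \<or> (v, u) \<in> D"
  using assms unfolding orientation_def by blast+

lemma orientation_insert:
  assumes "orientation (f - {{u, v}}) D" "{u, v} \<in> f" "u \<noteq> v"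
  shows "orientation f (insert (u, v) D)"
proof -
  have "(u, v) \<notin> D" "(v, u) \<notin> D"
    using orientationD(1)[OF assms(1), of u v] orientationD(1)[OF assms(1), of v u]
    by (auto simp: insert_commute)
  then show ?thesis
    unfolding orientation_def
  proof (intro conjI allI impI)
    fix a b assume "(a, b) \<in> insert (u, v) D"
    then show "{a, b} \<in> f" using orientationD(1)[OF assms(1)] assms(2) by blast
  next
    fix a b assume "(a, b) \<in> insert (u, v) D"
    then show "(b, a) \<notin> insert (u, v) D"
      using orientationD(2)[OF assms(1)] assms(3) \<open>(v, u) \<notin> D\<close> by blast
  next
    fix a b assume "{a, b} \<in> f"
    show "(a, b) \<in> insert (u, v) D \<or> (b, a) \<in> insert (u, v) D"
    proof (cases "{a, b} = {u, v}")
      case True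
      then show ?thesis by (auto simp: doubleton_eq_iff)
    next
      case False
      then show ?thesis using orientationD(3)[OF assms(1), of a b] \<open>{a, b} \<in> f\<close> by blast
    qed
  qed
qed

definition balanced :: "point set set \<Rightarrow> (point \<times> point) set \<Rightarrow> bool" where
  "balanced f D \<longleftrightarrow> (\<forall>v. degree f v = 2 \<longrightarrow> (\<exists>u. (u, v) \<in> D) \<and> (\<exists>w. (v, w) \<in> D))"

lemma degree_remove:
  assumes "finite f" "e \<in> f"
  shows "degree (f - {e}) v = (if v \<in> e then degree f v - 1 else degree f v)"
proof (cases "v \<in> e")
  case True
  have "{e' \<in> f - {e}. v \<in> e'} = {e' \<in> f. v \<in> e'} - {e}" by auto
  then show ?thesis using True assms by (simp add: degree_def)
next
  case False
  have "{e' \<in> f - {e}. v \<in> e'} = {e' \<in> f. v \<in> e'}" using False by auto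
  then show ?thesis using False by (simp add: degree_def)
qed

lemma degree_pos_iff:
  assumes "finite f" shows "0 < degree f v \<longleftrightarrow> (\<exists>e\<in>f. v \<in> e)"
  using assms by (auto simp: degree_def card_gt_0_iff)

lemma degree_pos_neighbour:
  assumes "finite f" "\<And>e. e \<in> f \<Longrightarrow> \<exists>u v. u \<noteq> v \<and> e = {u, v}" "0 < degree f w"
  obtains z where "w \<noteq> z" "{w, z} \<in> f"
proof -
  obtain e where e: "e \<in> f" "w \<in> e" using assms(1,3) degree_pos_iff by auto
  then obtain a b where "a \<noteq> b" "e = {a, b}" using assms(2) by blast
  then show thesis using e that[of a] that[of b] by (auto simp: insert_commute)
qed

text \<open>Induction on the number of edges: an edge at an end point \<open>u\<close> is removed and its other end
  point takes over the role of \<open>u\<close>; if there is no end point, any edge is removed and closes the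
  oriented path between its two ends to an oriented cycle.\<close>

lemma orientation_exists:
  assumes "finite f"
    and "\<And>e. e \<in> f \<Longrightarrow> \<exists>u v. u \<noteq> v \<and> e = {u, v}"
    and "\<And>v. degree f v \<le> 2"
    and "\<And>u v. degree f u = 1 \<Longrightarrow> degree f v = 1 \<Longrightarrow> u \<noteq> v \<Longrightarrow> path_connected f u v \<Longrightarrow>
           (u \<in> A) \<noteq> (v \<in> A)"
  shows "\<exists>D. orientation f D \<and> balanced f D \<and>
           (\<forall>v. degree f v = 1 \<longrightarrow> (v \<in> A \<longleftrightarrow> (\<exists>w. (v, w) \<in> D)))"
  using assms
proof (induction "card f" arbitrary: f A rule: less_induct)
  case less
  note fin = less.prems(1) and edge = less.prems(2) and deg = less.prems(3) and sep = less.prems(4)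
  \<comment> \<open>The induction hypothesis for \<open>f\<close> minus one edge, with the set of
    prescribed starting ends still free.\<close>
  have step: "\<exists>D. orientation (f - {{u, v}}) D \<and> balanced (f - {{u, v}}) D \<and>
      (\<forall>w. degree (f - {{u, v}}) w = 1 \<longrightarrow> (w \<in> A' \<longleftrightarrow> (\<exists>z. (w, z) \<in> D)))"
    if "{u, v} \<in> f" "\<And>w z. degree (f - {{u, v}}) w = 1 \<Longrightarrow> degree (f - {{u, v}}) z = 1 \<Longrightarrow> w \<noteq> z \<Longrightarrow>
        path_connected (f - {{u, v}}) w z \<Longrightarrow> (w \<in> A') \<noteq> (z \<in> A')" for u v A'
  proof (rule less.hyps)
    show "card (f - {{u, v}}) < card f" by (rule card_Diff1_less[OF fin that(1)])
    show "degree (f - {{u, v}}) w \<le> 2" for w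
      using deg[of w] by (auto simp: degree_remove[OF fin that(1)])
  qed (use that fin edge in auto)
  show ?case
  proof (cases "\<exists>u. degree f u = 1")
    case True
    then obtain u where u: "degree f u = 1" by blast
    then obtain v where e: "{u, v} \<in> f" and uv: "u \<noteq> v"
      using degree_pos_neighbour[OF fin edge, of u] u by (metis zero_less_one)
    let ?g = "f - {{u, v}}"
    have dg: "degree ?g w = (if w = u \<or> w = v then degree f w - 1 else degree f w)" for w
      by (simp add: degree_remove[OF fin e])
    have ug: "degree ?g u = 0" using u by (simp add: dg)
    hence nou: "u \<notin> e'" if "e' \<in> ?g" for e'
      using degree_pos_iff[of ?g u] fin that by auto
    define A' where "A' = (if u \<in> A then insert v A else A - {v})"
    have A': "w \<in> A' \<longleftrightarrow> (if w = v then u \<in> A else w \<in> A)" for w by (auto simp: A'_def)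
    \<comment> \<open>A path from \<open>v\<close> in \<open>?g\<close> avoids \<open>u\<close>,
      which has degree 0 there, and so extends by \<open>u\<close> to a path of \<open>f\<close>.
      Hence the separation of \<open>u\<close> and \<open>z\<close> carries over to \<open>v\<close>
      and \<open>z\<close>.\<close>
    have vw: "(v \<in> A') \<noteq> (z \<in> A')"
      if z: "degree ?g z = 1" "v \<noteq> z" "path_connected ?g v z" for z
    proof -
      obtain p where p: "is_path ?g p" "hd p = v" "last p = z"
        using z(3) unfolding path_connected_def by blast
      have zu: "z \<noteq> u" using that ug by auto
      have "u \<notin> set p"
      proof
        assume "u \<in> set p"
        then obtain i where i: "i < length p" "p ! i = u" by (auto simp: in_set_conv_nth)
        have "p \<noteq> []" using p by (simp add: is_path_def)
        then have "i \<noteq> 0" using p i uv by (metis hd_conv_nth)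
        then obtain j where "i = Suc j" by (cases i) auto
        then have "{p ! j, u} \<in> ?g" using p i by (auto simp: is_path_def)
        then show False using nou by blast
      qed
      moreover have "{(u # p) ! i, (u # p) ! Suc i} \<in> f" if "Suc i < length (u # p)" for i
        using that p e by (cases i) (auto simp: is_path_def hd_conv_nth)
      ultimately have "is_path f (u # p)" using p by (auto simp: is_path_def)
      then have "path_connected f u z"
        unfolding path_connected_def using p by (intro exI[of _ "u # p"]) (auto simp: is_path_def)
      moreover have "degree f z = 1" using that zu by (simp add: dg)
      ultimately have "(u \<in> A) \<noteq> (z \<in> A)" using sep u zu by blast
      then show ?thesis using that by (simp add: A')
    qed
    obtain D where D: "orientation ?g D" "balanced ?g D"
      "\<And>w. degree ?g w = 1 \<Longrightarrow> (w \<in> A' \<longleftrightarrow> (\<exists>z. (w, z) \<in> D))"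
    proof -
      have "(w \<in> A') \<noteq> (z \<in> A')"
        if "degree ?g w = 1" "degree ?g z = 1" "w \<noteq> z" "path_connected ?g w z" for w z
      proof -
        consider "w = v" | "z = v" | "w \<noteq> v" "z \<noteq> v" by blast
        then show ?thesis
        proof cases
          case 3
          have "w \<noteq> u" "z \<noteq> u" using that ug by auto
          then have "degree f w = 1" "degree f z = 1" using that 3 by (auto simp: dg)
          moreover have "path_connected f w z" using that path_connected_mono by blast
          ultimately show ?thesis using sep that 3 by (simp add: A')
        qed (use vw that path_connected_sym in blast)+
      qed
      from step[OF e this] show ?thesis using that by blast
    qed
    have Dg: "{a, b} \<in> ?g" if "(a, b) \<in> D" for a b using orientationD(1)[OF D(1) that] .
    have nouD: "(u, b) \<notin> D" "(b, u) \<notin> D" for b using Dg nou by blast+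
    define D' where "D' = insert (if u \<in> A then (u, v) else (v, u)) D"
    have D': "(a, b) \<in> D' \<longleftrightarrow> (if u \<in> A then a = u \<and> b = v else a = v \<and> b = u) \<or> (a, b) \<in> D" for a b
      by (simp add: D'_def)
    have "orientation f D'"
      using orientation_insert[of f u v D] orientation_insert[of f v u D] D(1) e uv
      by (simp add: insert_commute D'_def)
    moreover have "balanced f D'"
      unfolding balanced_def
    proof (intro allI impI)
      fix w assume w: "degree f w = 2"
      then have wu: "w \<noteq> u" using u by auto
      show "(\<exists>a. (a, w) \<in> D') \<and> (\<exists>b. (w, b) \<in> D')"
      proof (cases "w = v")
        case True
        then have dw: "degree ?g v = 1" using w by (simp add: dg)
        then obtain z where "{v, z} \<in> ?g"
          using degree_pos_neighbour[of ?g v] fin edge by (metis DiffD1 finite_Diff zero_less_one)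
        then have "(v, z) \<in> D \<or> (z, v) \<in> D" by (rule orientationD(3)[OF D(1)])
        moreover have "u \<in> A \<longleftrightarrow> (\<exists>z. (v, z) \<in> D)" using D(3)[OF dw] by (simp add: A')
        ultimately show ?thesis unfolding True D' by metis
      next
        case False
        then have "degree ?g w = 2" using w wu by (simp add: dg)
        then show ?thesis using D(2) unfolding balanced_def D' by blast
      qed
    qed
    moreover have "w \<in> A \<longleftrightarrow> (\<exists>z. (w, z) \<in> D')" if w: "degree f w = 1" for w
    proof (cases "w = u \<or> w = v")
      case True
      then show ?thesis
      proof
        assume wu: "w = u"
        show ?thesis unfolding wu D' using nouD uv by metis
      next
        \<comment> \<open>Here the removed edge is a whole component of \<open>f\<close>.\<close>
        assume wv: "w = v"
        then have "degree ?g v = 0" using w by (simp add: dg)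
        then have "\<And>z. (v, z) \<notin> D"
          using Dg degree_pos_iff[of ?g v] fin by (metis finite_Diff insertI1 less_irrefl)
        moreover have "(u \<in> A) \<noteq> (v \<in> A)"
          using sep u w wv uv path_connected_edge[OF e uv] by blast
        ultimately show ?thesis unfolding wv D' using uv by metis
      qed
    next
      case False
      then have "degree ?g w = 1" using w by (simp add: dg)
      then have "w \<in> A \<longleftrightarrow> (\<exists>z. (w, z) \<in> D)" using D(3)[of w] False by (simp add: A')
      then show ?thesis unfolding D' using False by metis
    qed
    ultimately show ?thesis by blast
  next
    case nodeg1: False
    show ?thesis
    proof (cases "f = {}")
      case True
      then show ?thesis
        by (intro exI[of _ "{}"]) (auto simp: orientation_def balanced_def degree_def)
    next
      case False
      then obtain e where "e \<in> f" by blast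
      then obtain u v where e: "{u, v} \<in> f" and uv: "u \<noteq> v" using edge[of e] by blast
      let ?g = "f - {{u, v}}"
      have d2: "degree f w = 2" if "w \<in> {u, v}" for w
      proof -
        have "0 < degree f w" using degree_pos_iff[OF fin] e that by blast
        moreover have "degree f w \<noteq> 1" using nodeg1 by blast
        ultimately show ?thesis using deg[of w] by arith
      qed
      have dg: "degree ?g w = (if w = u \<or> w = v then degree f w - 1 else degree f w)" for w
        by (simp add: degree_remove[OF fin e])
      have d1: "w = u \<or> w = v" if "degree ?g w = 1" for w
        using that nodeg1 unfolding dg by metis
      \<comment> \<open>All degrees in \<open>f\<close> are 0 or 2, so only \<open>u\<close> and
        \<open>v\<close> have degree 1 in \<open>?g\<close>. Prescribing \<open>{u}\<close> makes
        \<open>u\<close> a start and \<open>v\<close> an end, so the arc to be put back is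
        \<open>(v, u)\<close>.\<close>
      obtain D where D: "orientation ?g D" "balanced ?g D"
        "\<And>w. degree ?g w = 1 \<Longrightarrow> (w \<in> {u} \<longleftrightarrow> (\<exists>z. (w, z) \<in> D))"
      proof -
        have "(w \<in> {u}) \<noteq> (z \<in> {u})" if "degree ?g w = 1" "degree ?g z = 1" "w \<noteq> z" for w z
          using that d1[of w] d1[of z] by auto
        from step[OF e this] show ?thesis using that by blast
      qed
      have "orientation f (insert (v, u) D)"
        using orientation_insert[of f v u D] D(1) e uv by (simp add: insert_commute)
      moreover have "balanced f (insert (v, u) D)"
        unfolding balanced_def
      proof (intro allI impI)
        fix w assume w: "degree f w = 2"
        show "(\<exists>a. (a, w) \<in> insert (v, u) D) \<and> (\<exists>b. (w, b) \<in> insert (v, u) D)"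
        proof (cases "w = u \<or> w = v")
          case True
          then have d: "degree ?g w = 1" using d2[of w] by (simp add: dg)
          then obtain z where "{w, z} \<in> ?g"
            using degree_pos_neighbour[of ?g w] fin edge by (metis DiffD1 finite_Diff zero_less_one)
          then have "(w, z) \<in> D \<or> (z, w) \<in> D" by (rule orientationD(3)[OF D(1)])
          then show ?thesis using D(3)[OF d] True uv by (metis insertI1 insertI2 singleton_iff)
        next
          case False
          then have "degree ?g w = 2" using w by (simp add: dg)
          then show ?thesis using D(2) unfolding balanced_def by blast
        qed
      qed
      ultimately show ?thesis using nodeg1 by blast
    qed
  qed
qed

text \<open>An edge oriented from an odd to an even vertex gets the colour \<open>True\<close>, other edges get
  the colour \<open>False\<close>; balance of the orientation says that both colour classes are matchings.\<close>

lemma two_colouring: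
  assumes fin: "finite f"
    and edge: "\<forall>e\<in>f. \<exists>u v. e = {u, v} \<and> even (fst u + snd u) \<noteq> even (fst v + snd v)"
    and deg: "\<forall>v. degree f v \<le> 2"
    and sep: "\<forall>u v. degree f u = 1 \<longrightarrow> degree f v = 1 \<longrightarrow> u \<noteq> v \<longrightarrow> path_connected f u v \<longrightarrow>
           (u \<in> A) \<noteq> (v \<in> A)"
  shows "\<exists>(C :: bool \<Rightarrow> point set) (\<mu> :: bool \<Rightarrow> point \<Rightarrow> point).
    (\<forall>c. \<forall>u\<in>C c. {u, \<mu> c u} \<in> f \<and> \<mu> c u \<in> C c \<and> \<mu> c (\<mu> c u) = u) \<and>
    (\<forall>u\<in>C True \<inter> C False. \<mu> True u \<noteq> \<mu> False u) \<and>
    (\<forall>c u. degree f u = 2 \<longrightarrow> u \<in> C c) \<and>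
    (\<forall>c u. degree f u = 1 \<longrightarrow> (u \<in> C c \<longleftrightarrow> (even (fst u + snd u) = c) = (u \<in> A)))"
proof -
  have "\<exists>u v. u \<noteq> v \<and> e = {u, v}" if "e \<in> f" for e using edge[rule_format, OF that] by metis
  then have "\<exists>D. orientation f D \<and> balanced f D \<and>
      (\<forall>v. degree f v = 1 \<longrightarrow> (v \<in> A \<longleftrightarrow> (\<exists>w. (v, w) \<in> D)))"
    by (intro orientation_exists fin) (simp_all add: deg sep)
  then obtain D where D: "orientation f D" "balanced f D"
    "\<And>v. degree f v = 1 \<Longrightarrow> (v \<in> A \<longleftrightarrow> (\<exists>w. (v, w) \<in> D))"
    by blast
  \<comment> \<open>\<open>m c\<close> relates the two ends of an arc of colour \<open>c\<close>, in
    either order; it is symmetric because the ends have different parity.\<close>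
  define m where "m c u v \<longleftrightarrow> (if even (fst u + snd u) = c then (u, v) \<in> D else (v, u) \<in> D)" for c u v
  have par: "even (fst u + snd u) \<noteq> even (fst v + snd v)" if "{u, v} \<in> f" for u v
    using edge[rule_format, OF that] by (metis doubleton_eq_iff)
  have m_edge: "{u, v} \<in> f" if "m c u v" for c u v
  proof -
    have "(u, v) \<in> D \<or> (v, u) \<in> D" using that unfolding m_def by presburger
    then show ?thesis using orientationD(1)[OF D(1)] by (metis insert_commute)
  qed
  have m_sym: "m c v u" if "m c u v" for c u v
    using that par[OF m_edge[rule_format, OF that]] unfolding m_def by metis
  \<comment> \<open>A second outgoing arc forces degree 2, and then balance supplies an incoming
    arc, which would be a third edge.\<close>
  have out: "v = w" if "(u, v) \<in> D" "(u, w) \<in> D" for u v w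
  proof (rule ccontr)
    assume ne: "v \<noteq> w"
    have e: "{u, v} \<in> f" "{u, w} \<in> f" using orientationD(1)[OF D(1)] that by blast+
    then have "degree f u = 2" using degree_gt_1[OF fin e ne] deg[rule_format, of u] by simp
    then obtain z where z: "(z, u) \<in> D" using D(2) unfolding balanced_def by blast
    then have "{u, z} \<in> f" using orientationD(1)[OF D(1)] by (metis insert_commute)
    moreover have "z \<noteq> v" "z \<noteq> w" using orientationD(2)[OF D(1)] that z by blast+
    ultimately have "degree f u \<ge> 3" using degree_gt_2[OF fin e] ne by metis
    then show False using deg[rule_format, of u] by simp
  qed
  have into: "v = w" if "(v, u) \<in> D" "(w, u) \<in> D" for u v w
  proof (rule ccontr)
    assume ne: "v \<noteq> w"
    have e: "{u, v} \<in> f" "{u, w} \<in> f" using orientationD(1)[OF D(1)] that by (metis insert_commute)+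
    then have "degree f u = 2" using degree_gt_1[OF fin e ne] deg[rule_format, of u] by simp
    then obtain z where z: "(u, z) \<in> D" using D(2) unfolding balanced_def by blast
    then have "{u, z} \<in> f" using orientationD(1)[OF D(1)] by blast
    moreover have "z \<noteq> v" "z \<noteq> w" using orientationD(2)[OF D(1)] that z by blast+
    ultimately have "degree f u \<ge> 3" using degree_gt_2[OF fin e] ne by metis
    then show False using deg[rule_format, of u] by simp
  qed
  have uniq: "v = w" if "m c u v" "m c u w" for c u v w
    using that out into unfolding m_def by metis
  define C where "C c = {u. \<exists>v. m c u v}" for c
  define \<mu> where "\<mu> c u = (SOME v. m c u v)" for c u
  have mu: "m c u (\<mu> c u)" if "u \<in> C c" for c u
    using that unfolding C_def \<mu>_def mem_Collect_eq by (rule someI_ex)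
  show ?thesis
  proof (intro exI[of _ C] exI[of _ \<mu>] conjI allI ballI impI)
    fix c u assume u: "u \<in> C c"
    show "{u, \<mu> c u} \<in> f" using m_edge[OF mu[OF u]] .
    show *: "\<mu> c u \<in> C c" using m_sym[OF mu[OF u]] unfolding C_def by blast
    show "\<mu> c (\<mu> c u) = u" using uniq[OF mu[OF *] m_sym[OF mu[OF u]]] .
  next
    fix u assume "u \<in> C True \<inter> C False"
    then have "m True u (\<mu> True u)" "m False u (\<mu> False u)" using mu by blast+
    then show "\<mu> True u \<noteq> \<mu> False u" using orientationD(2)[OF D(1)] unfolding m_def by metis
  next
    show "u \<in> C c" if "degree f u = 2" for c u
      using D(2) that unfolding C_def m_def balanced_def mem_Collect_eq by metis
    show "u \<in> C c \<longleftrightarrow> (even (fst u + snd u) = c) = (u \<in> A)" if d: "degree f u = 1" for c u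
    proof -
      obtain v where v: "{u, v} \<in> f"
        using degree_pos_neighbour[OF fin, of u] edge d by (metis zero_less_one)
      then have uv: "(u, v) \<in> D \<or> (v, u) \<in> D" using orientationD(3)[OF D(1)] by blast
      have "w = v" if "{u, w} \<in> f" for w
        using degree_gt_1[OF fin that v] d by fastforce
      then have "(u, w) \<in> D \<or> (w, u) \<in> D \<Longrightarrow> w = v" for w
        using orientationD(1)[OF D(1)] by (metis insert_commute)
      then have "(\<exists>w. (u, w) \<in> D) \<longleftrightarrow> \<not> (\<exists>w. (w, u) \<in> D)"
        using uv orientationD(2)[OF D(1)] by metis
      then show ?thesis using D(3)[OF d] unfolding C_def m_def mem_Collect_eq by metis
    qed
  qed
qed

lemma path_connected_degree_pos:
  assumes "finite f" "path_connected f u v" "u \<noteq> v"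
  shows "0 < degree f u"
proof -
  obtain p where p: "is_path f p" "hd p = u" "last p = v" using assms unfolding path_connected_def by blast
  obtain q where q: "p = u # q" using p by (cases p) (auto simp: is_path_def)
  then obtain z r where "p = u # z # r" using p assms(3) by (cases q) auto
  then have "{u, z} \<in> f" using p(1) unfolding is_path_def by (metis length_Cons nth_Cons_0 nth_Cons_Suc zero_less_Suc Suc_less_eq)
  then show ?thesis using degree_pos_iff[OF assms(1)] by blast
qed

section \<open>The hexagon is bipartite and finite\<close>

lemma hex_edges_parity:
  assumes "e \<in> hex_edges K L M N"
  shows "\<exists>u v. e = {u, v} \<and> even (fst u + snd u) \<noteq> even (fst v + snd v)"
proof -
  obtain u v where e: "e = {u, v}" "(fst u - fst v)\<^sup>2 + (snd u - snd v)\<^sup>2 = 1"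
    using assms by (auto simp: hex_edges_def)
  have "odd ((fst u - fst v)\<^sup>2 + (snd u - snd v)\<^sup>2)" unfolding e(2) by simp
  then have "odd ((fst u - fst v) + (snd u - snd v))" by simp
  then have "even (fst u + snd u) \<noteq> even (fst v + snd v)" by presburger
  then show ?thesis using e by blast
qed

lemma hex_edgesD:
  assumes "{u, v} \<in> hex_edges K L M N"
  shows "u \<in> hex_verts K L M N" "(fst u - fst v)\<^sup>2 + (snd u - snd v)\<^sup>2 = 1"
proof -
  obtain a b where ab: "{u, v} = {a, b}" "a \<in> hex_verts K L M N" "b \<in> hex_verts K L M N"
    "(fst a - fst b)\<^sup>2 + (snd a - snd b)\<^sup>2 = 1"
    using assms unfolding hex_edges_def by blast
  then have "u = a \<and> v = b \<or> u = b \<and> v = a" by (auto simp: doubleton_eq_iff)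
  then show "u \<in> hex_verts K L M N" "(fst u - fst v)\<^sup>2 + (snd u - snd v)\<^sup>2 = 1"
    using ab(2-4) by (metis power2_commute)+
qed

lemma finite_hex_verts: "finite (hex_verts K L M N)"
proof (rule finite_subset)
  show "hex_verts K L M N \<subseteq> {0..int (2 * K + 2 * L + M + N)} \<times> {- int (M + N)..int K}"
    by (auto simp: hex_verts_def)
qed simp

lemma finite_hex_edges: "finite (hex_edges K L M N)"
proof (rule finite_subset)
  show "hex_edges K L M N \<subseteq> (\<lambda>(u, v). {u, v}) ` (hex_verts K L M N \<times> hex_verts K L M N)"
    by (auto simp: hex_edges_def)
qed (simp add: finite_hex_verts)

section \<open>One matching of the hexagon\<close>

text \<open>The two \<open>notin\<close> assumptions concern the vertices that the reference
  matching cannot use: odd vertices on the upper right side have no right neighbour in the hexagon,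
  even vertices on the lower left side no left neighbour. The two \<open>uncovered\<close>
  assumptions confine all other uncovered vertices to the places where paths may start (upper left
  side, top row) or end (bottom row, lower right side).\<close>

locale hex_matching =
  fixes K L M N :: nat and C :: "point set" and \<mu> :: "point \<Rightarrow> point"
  assumes KMN: "K \<le> M + N" and NKL: "N \<le> K + L" and MN: "1 \<le> M + N"
    and C_subset: "C \<subseteq> hex_verts K L M N"
    and mu_in: "v \<in> C \<Longrightarrow> \<mu> v \<in> C"
    and mu_mu: "v \<in> C \<Longrightarrow> \<mu> (\<mu> v) = v"
    and mu_adj: "v \<in> C \<Longrightarrow> (fst v - fst (\<mu> v))\<^sup>2 + (snd v - snd (\<mu> v))\<^sup>2 = 1"
    and RT_notin: "x + y = 2 * (int K + int L) \<Longrightarrow> (x, y) \<notin> C"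
    and LB_notin: "x + y = - 1 \<Longrightarrow> (x, y) \<notin> C"
    and uncovered_odd: "(x, y) \<in> hex_verts K L M N \<Longrightarrow> even (x + y) \<Longrightarrow> (x, y) \<notin> C \<Longrightarrow>
           x + y = 2 * (int K + int L) \<or> x = y \<or> y = int K - 1"
    and uncovered_even: "(x, y) \<in> hex_verts K L M N \<Longrightarrow> odd (x + y) \<Longrightarrow> (x, y) \<notin> C \<Longrightarrow>
           x + y = - 1 \<or> y = int K - int M - int N \<or> x - y = 2 * (int M + int L) + 1"
begin

abbreviation "V \<equiv> hex_verts K L M N"

text \<open>For the blue matching this vertex carries letter \<open>i\<close> (from 0) of
  \<open>l_T t\<close> and has \<open>x + y = 2 * i\<close>; likewise \<open>sink_pt i\<close>
  carries letter \<open>i\<close> of \<open>b r_B\<close> and has \<open>x + y = 2 * i + 1\<close>.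
  Positions in the words can therefore be read off from \<open>x + y\<close>.\<close>

definition source_pt :: "nat \<Rightarrow> point" where
  "source_pt i = (if i < K then (int i, int i) else (2 * int i - int K + 1, int K - 1))"

definition sink_pt :: "nat \<Rightarrow> point" where
  "sink_pt i = (if i < K + L - N then (int M + int N - int K + 1 + 2 * int i, int K - int M - int N)
                else (int M + int L + int i + 1, int i - int M - int L))"

definition sources :: "nat set" where
  "sources = {i. i < K + L \<and> source_pt i \<notin> C}"

definition sinks :: "nat set" where
  "sinks = {i. i < K + L \<and> sink_pt i \<notin> C}"

definition odds :: "point set" where
  "odds = {v \<in> C. even (fst v + snd v)}"

lemma finite_sources [simp]: "finite sources" and finite_sinks [simp]: "finite sinks"
  by (auto simp: sources_def sinks_def)

lemma V_iff: "(x, y) \<in> V \<longleftrightarrow> y \<le> x \<and> y \<le> int K - 1 \<and> y \<le> - x + 2 * (int K + int L) \<and>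
      y \<ge> - x - 1 \<and> y \<ge> - int M - int N + int K \<and> y \<ge> x - 2 * (int M + int L) - 1"
  by (simp add: hex_verts_def)

lemma V_x_nonneg: "(x, y) \<in> V \<Longrightarrow> 0 \<le> x"
  by (auto simp: V_iff)

lemma V_x_le: "(x, y) \<in> V \<Longrightarrow> x \<le> int (2 * K + 2 * L + M + N)"
  by (auto simp: V_iff)

lemma finite_C: "finite C" using finite_hex_verts C_subset finite_subset by blast

lemma finite_odds [simp]: "finite odds" using finite_C by (simp add: odds_def)

lemma source_pt_V: "i < K + L \<Longrightarrow> source_pt i \<in> V"
  using KMN NKL MN by (auto simp: source_pt_def V_iff)

lemma sink_pt_V: "i < K + L \<Longrightarrow> sink_pt i \<in> V"
  using KMN NKL MN by (auto simp: sink_pt_def V_iff)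

lemma source_pt_sum: "fst (source_pt i) + snd (source_pt i) = 2 * int i"
  by (auto simp: source_pt_def)

lemma sink_pt_sum: "fst (sink_pt i) + snd (sink_pt i) = 2 * int i + 1"
  by (auto simp: sink_pt_def)

lemma inj_source_pt: "inj_on source_pt S"
  by (rule inj_onI) (metis of_nat_eq_iff mult_cancel_left source_pt_sum zero_neq_numeral)

lemma inj_sink_pt: "inj_on sink_pt S"
  by (rule inj_onI) (metis add_right_cancel of_nat_eq_iff mult_cancel_left sink_pt_sum zero_neq_numeral)

lemma neighbour_cases:
  fixes a b x y :: int
  assumes "(x - a)\<^sup>2 + (y - b)\<^sup>2 = 1"
  shows "(a, b) \<in> {(x + 1, y), (x - 1, y), (x, y + 1), (x, y - 1)}"
proof -
  have "(x - a)\<^sup>2 \<le> 1" "(y - b)\<^sup>2 \<le> 1"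
    using assms zero_le_power2[of "x - a"] zero_le_power2[of "y - b"] by linarith+
  then have "\<bar>x - a\<bar> \<le> 1" "\<bar>y - b\<bar> \<le> 1"
    by (simp_all add: abs_square_le_1)
  then have "x - a \<in> {-1, 0, 1}" "y - b \<in> {-1, 0, 1}" by auto
  then show ?thesis using assms by auto
qed

lemma mu_cases:
  assumes "(x, y) \<in> C"
  obtains "\<mu> (x, y) = (x + 1, y)" | "\<mu> (x, y) = (x - 1, y)"
    | "\<mu> (x, y) = (x, y + 1)" | "\<mu> (x, y) = (x, y - 1)"
  using neighbour_cases[of x "fst (\<mu> (x, y))" y "snd (\<mu> (x, y))"] mu_adj[OF assms]
  by (cases "\<mu> (x, y)") auto

lemma mu_parity: "v \<in> C \<Longrightarrow> even (fst (\<mu> v) + snd (\<mu> v)) \<longleftrightarrow> odd (fst v + snd v)"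
  by (cases v) (auto elim!: mu_cases)

lemma odd_vertex_right:
  assumes "(x, y) \<in> V" "even (x + y)" "x + y \<noteq> 2 * (int K + int L)" shows "(x + 1, y) \<in> V"
proof -
  have "x - y \<noteq> 2 * (int M + int L) + 1" using assms(2) by presburger
  then show ?thesis using assms by (auto simp: V_iff)
qed

lemma even_vertex_left:
  assumes "(x, y) \<in> V" "odd (x + y)" "x + y \<noteq> -1" shows "(x - 1, y) \<in> V"
proof -
  have "x \<noteq> y" using assms(2) by auto
  then show ?thesis using assms by (auto simp: V_iff)
qed

text \<open>The odd vertices met by the reference matching but not by \<open>C\<close> are the
  starts of the paths of the superposition; \<open>uncovered_evens\<close> gives their ends.\<close>

lemma uncovered_odds:
  "{v \<in> V. even (fst v + snd v) \<and> fst v + snd v \<noteq> 2 * (int K + int L) \<and> v \<notin> C}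
     = source_pt ` sources"
proof (intro set_eqI iffI)
  fix v assume "v \<in> {v \<in> V. even (fst v + snd v) \<and> fst v + snd v \<noteq> 2 * (int K + int L) \<and> v \<notin> C}"
  then obtain x y where v: "v = (x, y)" "(x, y) \<in> V" "even (x + y)" "x + y \<noteq> 2 * (int K + int L)"
    "(x, y) \<notin> C" by (cases v) auto
  define i where "i = nat ((x + y) div 2)"
  have "x + y \<noteq> - 1" using v(3) by (metis even_minus odd_one)
  moreover have "- 1 \<le> x + y" using v(2) by (simp add: V_iff)
  ultimately have x0: "0 \<le> x + y" by linarith
  have i2: "2 * int i = x + y" using v(3) x0 by (auto simp: i_def)
  have "x = y \<or> y = int K - 1" using uncovered_odd[of x y] v by auto
  then have "v = source_pt i" using i2 v by (auto simp: source_pt_def V_iff)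
  moreover have "i < K + L" using i2 v by (auto simp: V_iff)
  ultimately show "v \<in> source_pt ` sources" using v by (auto simp: sources_def)
next
  fix v assume "v \<in> source_pt ` sources"
  then obtain i where "i < K + L" "v = source_pt i" "v \<notin> C" by (auto simp: sources_def)
  moreover have "even (fst (source_pt i) + snd (source_pt i))"
    "fst (source_pt i) + snd (source_pt i) \<noteq> 2 * (int K + int L)" if "i < K + L"
    using that unfolding source_pt_sum by simp_all
  ultimately show "v \<in> {v \<in> V. even (fst v + snd v) \<and> fst v + snd v \<noteq> 2 * (int K + int L) \<and> v \<notin> C}"
    using source_pt_V[of i] by blast
qed

lemma uncovered_evens:
  "{v \<in> V. odd (fst v + snd v) \<and> fst v + snd v \<noteq> - 1 \<and> v \<notin> C} = sink_pt ` sinks"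
proof (intro set_eqI iffI)
  fix v assume "v \<in> {v \<in> V. odd (fst v + snd v) \<and> fst v + snd v \<noteq> - 1 \<and> v \<notin> C}"
  then obtain x y where v: "v = (x, y)" "(x, y) \<in> V" "odd (x + y)" "x + y \<noteq> - 1"
    "(x, y) \<notin> C" by (cases v) auto
  define i where "i = nat ((x + y) div 2)"
  have x0: "0 \<le> x + y" using v by (auto simp: V_iff)
  have i2: "2 * int i + 1 = x + y" using v(3) x0 by (auto simp: i_def) 
  have "y = int K - int M - int N \<or> x - y = 2 * (int M + int L) + 1"
    using uncovered_even[of x y] v by auto
  then have "v = sink_pt i" using i2 v NKL KMN by (auto simp: sink_pt_def V_iff)
  moreover have "i < K + L" using i2 v by (auto simp: V_iff)
  ultimately show "v \<in> sink_pt ` sinks" using v by (auto simp: sinks_def)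
next
  fix v assume "v \<in> sink_pt ` sinks"
  then obtain i where "i < K + L" "v = sink_pt i" "v \<notin> C" by (auto simp: sinks_def)
  moreover have "odd (fst (sink_pt i) + snd (sink_pt i))"
    "fst (sink_pt i) + snd (sink_pt i) \<noteq> - 1"
    unfolding sink_pt_sum by simp_all
  ultimately show "v \<in> {v \<in> V. odd (fst v + snd v) \<and> fst v + snd v \<noteq> - 1 \<and> v \<notin> C}"
    using sink_pt_V[of i] by blast
qed

definition right :: "point \<Rightarrow> point" where "right v = (fst v + 1, snd v)"

text \<open>Superimpose the matching with the reference matching of each odd vertex with its right
  neighbour, and telescope \<open>g\<close> along the resulting paths.\<close>

lemma matching_sum:
  fixes g :: "point \<Rightarrow> int"
  shows "(\<Sum>i\<in>sources. g (right (source_pt i))) - (\<Sum>i\<in>sinks. g (sink_pt i))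
           = (\<Sum>v\<in>odds. g (\<mu> v) - g (right v))"
proof -
  \<comment> \<open>\<open>U\<close> and \<open>E\<close> are the odd and even vertices met by the
    reference matching. The bijections \<open>right\<close> from \<open>U\<close> to
    \<open>E\<close> and \<open>\<mu>\<close> from \<open>odds\<close> to \<open>evens\<close>
    relate the sums; \<open>U - odds\<close> and \<open>E - evens\<close> are the starts and
    ends.\<close>
  define U where "U = {v \<in> V. even (fst v + snd v) \<and> fst v + snd v \<noteq> 2 * (int K + int L)}"
  define E where "E = {v \<in> V. odd (fst v + snd v) \<and> fst v + snd v \<noteq> - 1}"
  define evens where "evens = {v \<in> C. odd (fst v + snd v)}"
  have fin: "finite U" "finite E" using finite_hex_verts by (auto simp: U_def E_def)
  have "bij_betw right U E"
  proof (rule bij_betw_byWitness[where f' = "\<lambda>v. (fst v - 1, snd v)"])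
    show "right ` U \<subseteq> E"
    proof
      fix w assume "w \<in> right ` U"
      then obtain x y where v: "w = (x + 1, y)" "(x, y) \<in> V" "even (x + y)" "x + y \<noteq> 2 * (int K + int L)"
        by (auto simp: U_def right_def)
      moreover have "x + y \<noteq> -2" using v by (auto simp: V_iff)
      ultimately show "w \<in> E" using odd_vertex_right[of x y] by (auto simp: E_def)
    qed
    show "(\<lambda>v. (fst v - 1, snd v)) ` E \<subseteq> U"
    proof
      fix w assume "w \<in> (\<lambda>v. (fst v - 1, snd v)) ` E"
      then obtain x y where v: "w = (x - 1, y)" "(x, y) \<in> V" "odd (x + y)" "x + y \<noteq> - 1"
        by (auto simp: E_def)
      moreover have "x - 1 + y \<noteq> 2 * (int K + int L)" using v by (auto simp: V_iff)
      ultimately show "w \<in> U" using even_vertex_left[of x y] by (auto simp: U_def)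
    qed
  qed (auto simp: right_def)
  then have "(\<Sum>v\<in>U. g (right v)) = (\<Sum>v\<in>E. g v)" by (rule sum.reindex_bij_betw)
  moreover have "odds \<subseteq> U" using C_subset RT_notin by (fastforce simp: odds_def U_def)
  then have "(\<Sum>v\<in>U. g (right v)) = (\<Sum>v\<in>U - odds. g (right v)) + (\<Sum>v\<in>odds. g (right v))"
    using fin by (simp add: sum.subset_diff)
  moreover have "evens \<subseteq> E" using C_subset LB_notin by (fastforce simp: evens_def E_def)
  then have "(\<Sum>v\<in>E. g v) = (\<Sum>v\<in>E - evens. g v) + (\<Sum>v\<in>evens. g v)"
    using fin by (simp add: sum.subset_diff)
  moreover have "U - odds = source_pt ` sources"
    unfolding uncovered_odds[symmetric] by (auto simp: U_def odds_def)
  then have "(\<Sum>v\<in>U - odds. g (right v)) = (\<Sum>i\<in>sources. g (right (source_pt i)))"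
    by (simp add: sum.reindex inj_source_pt)
  moreover have "E - evens = sink_pt ` sinks"
    unfolding uncovered_evens[symmetric] by (auto simp: E_def evens_def)
  then have "(\<Sum>v\<in>E - evens. g v) = (\<Sum>i\<in>sinks. g (sink_pt i))"
    by (simp add: sum.reindex inj_sink_pt)
  ultimately have sums: "(\<Sum>i\<in>sources. g (right (source_pt i))) + (\<Sum>v\<in>odds. g (right v))
      = (\<Sum>i\<in>sinks. g (sink_pt i)) + (\<Sum>v\<in>evens. g v)"
    by simp
  have oe: "\<mu> v \<in> evens" if "v \<in> odds" for v
    using that mu_in[of v] mu_parity[of v] unfolding odds_def evens_def by blast
  have eo: "\<mu> v \<in> odds" if "v \<in> evens" for v
    using that mu_in[of v] mu_parity[of v] unfolding odds_def evens_def by blast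
  have "bij_betw \<mu> odds evens"
    by (intro bij_betw_byWitness[where f' = \<mu>]) (use oe eo in \<open>auto simp: mu_mu odds_def evens_def\<close>)
  then have "(\<Sum>v\<in>odds. g (\<mu> v)) = (\<Sum>v\<in>evens. g v)" by (rule sum.reindex_bij_betw)
  from this sums show ?thesis by (simp add: sum_subtractf)
qed

lemma odds_cases:
  assumes "v \<in> odds"
  obtains x y where "v = (x, y)" "even (x + y)" "\<mu> v = (x + 1, y)"
  | x y where "v = (x, y)" "even (x + y)" "\<mu> v = (x - 1, y)"
  | x y where "v = (x, y)" "even (x + y)" "\<mu> v = (x, y + 1)"
  | x y where "v = (x, y)" "even (x + y)" "\<mu> v = (x, y - 1)"
proof -
  obtain x y where v: "v = (x, y)" "(x, y) \<in> C" "even (x + y)"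
    using assms by (cases v) (auto simp: odds_def)
  show thesis using v(2) by (rule mu_cases) (use v that in auto)
qed

section \<open>Consequences of telescoping for the ends of paths\<close>

lemma card_sources: "card sources = card sinks"
  using matching_sum[of "\<lambda>_. 1"] by simp

text \<open>The weight is the indicator of \<open>x + y \<le> 2 * m - 1\<close>. No neighbour of an
  odd vertex \<open>v\<close> has larger \<open>x + y\<close> than \<open>right v\<close>, so every
  summand of \<open>matching_sum\<close> over \<open>odds\<close> is nonnegative.\<close>

lemma card_prefix: "card {i \<in> sinks. i < m} \<le> card {i \<in> sources. i < m}"
proof -
  let ?g = "\<lambda>v::point. of_bool (fst v + snd v \<le> 2 * int m - 1) :: int"
  have 1: "?g (right (source_pt i)) = of_bool (i < m)" for i
    using source_pt_sum[of i] by (auto simp: right_def)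
  have 2: "?g (sink_pt i) = of_bool (i < m)" for i
    using sink_pt_sum[of i] by (auto simp: right_def)
  have "(\<Sum>v\<in>odds. ?g (\<mu> v) - ?g (right v)) \<ge> 0"
    by (intro sum_nonneg) (erule odds_cases; auto simp: right_def)
  then have "(\<Sum>i\<in>sinks. of_bool (i < m) :: int) \<le> (\<Sum>i\<in>sources. of_bool (i < m))"
    using matching_sum[of ?g] unfolding 1 2 by linarith
  then show ?thesis
    by (simp add: sum_of_bool_eq Int_def conj_commute)
qed

definition left_edges :: "point set" where
  "left_edges = {v \<in> odds. \<mu> v = (fst v - 1, snd v)}"

text \<open>With this weight an odd vertex contributes 1 if its partner lies to the left or below,
  and 0 otherwise. The vertical contributions are dropped, as \<open>card_shared\<close> produces
  horizontal edges only.\<close>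

lemma sum_indices: "int (\<Sum>sinks) - int (\<Sum>sources) \<ge> int (card left_edges)"
proof -
  let ?g = "\<lambda>v::point. - ((fst v + snd v - 1) div 2)"
  have 1: "?g (right (source_pt i)) = - int i" for i
    using source_pt_sum[of i] by (auto simp: right_def)
  have 2: "?g (sink_pt i) = - int i" for i
    using sink_pt_sum[of i] by (auto simp: right_def)
  have "(\<Sum>v\<in>odds. ?g (\<mu> v) - ?g (right v)) \<ge> (\<Sum>v\<in>odds. of_bool (\<mu> v = (fst v - 1, snd v)))"
  proof (intro sum_mono)
    fix v assume "v \<in> odds"
    then show "of_bool (\<mu> v = (fst v - 1, snd v)) \<le> ?g (\<mu> v) - ?g (right v)"
      by (cases rule: odds_cases) (auto simp: right_def elim!: evenE)
  qed
  also have "(\<Sum>v\<in>odds. of_bool (\<mu> v = (fst v - 1, snd v)) :: int) = int (card left_edges)"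
    by (simp add: sum_of_bool_eq left_edges_def Int_def)
  finally show ?thesis
    using matching_sum[of ?g] unfolding 1 2 by (simp add: sum_negf)
qed

text \<open>\<open>occ c\<close> collects the heights at which the paths formed by matching and reference matching
  traverse the gap between the columns \<open>c\<close> and \<open>c + 1\<close>.\<close>

definition occ :: "int \<Rightarrow> int set" where
  "occ c = {y. if even (c + y)
               then (c, y) \<in> V \<and> (c + 1, y) \<in> V \<and> \<not> ((c, y) \<in> C \<and> \<mu> (c, y) = (c + 1, y))
               else (c, y) \<in> C \<and> \<mu> (c, y) = (c + 1, y)}"

lemma occ_V: "y \<in> occ c \<Longrightarrow> (c, y) \<in> V \<and> (c + 1, y) \<in> V"
  using C_subset mu_in[of "(c, y)"] by (auto simp: occ_def split: if_splits)

lemma finite_occ [simp]: "finite (occ c)"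
proof (rule finite_subset)
  show "occ c \<subseteq> snd ` V" using occ_V by force
qed (simp add: finite_hex_verts)

lemma snd_image_column: "snd ` {v. fst v = c \<and> P v} = {y. P (c, y)}"
  by force

text \<open>With the indicator of \<open>x \<le> c\<close> as weight, an odd vertex contributes 1
  exactly when its reference edge (\<open>A\<close>) or its matching edge (\<open>B\<close>) carries
  a path across the gap. Sources in column \<open>c\<close> (\<open>S\<close>) are added separately,
  because \<open>matching_sum\<close> evaluates sources at their right neighbours, beyond the gap.
  An edge in both matchings is a closed path and does not count.\<close>

lemma card_occ:
  "int (card (occ c)) = int (card {i \<in> sources. fst (source_pt i) \<le> c})
                          - int (card {i \<in> sinks. fst (sink_pt i) \<le> c})"
proof -
  let ?g = "\<lambda>v::point. of_bool (fst v \<le> c) :: int"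
  define A where "A = {v \<in> odds. fst v = c \<and> \<mu> v \<noteq> right v}"
  define B where "B = {v \<in> odds. fst v = c + 1 \<and> \<mu> v = (fst v - 1, snd v)}"
  define S where "S = {i \<in> sources. fst (source_pt i) = c}"
  have fin: "finite A" "finite B" "finite S" by (simp_all add: A_def B_def S_def)
  have "?g (\<mu> v) - ?g (right v) = of_bool (fst v = c \<and> \<mu> v \<noteq> right v)
      + of_bool (fst v = c + 1 \<and> \<mu> v = (fst v - 1, snd v))" if "v \<in> odds" for v
    using that by (cases rule: odds_cases) (auto simp: right_def)
  then have "(\<Sum>v\<in>odds. ?g (\<mu> v) - ?g (right v))
      = (\<Sum>v\<in>odds. of_bool (fst v = c \<and> \<mu> v \<noteq> right v))
        + (\<Sum>v\<in>odds. of_bool (fst v = c + 1 \<and> \<mu> v = (fst v - 1, snd v)))"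
    by (simp add: sum.distrib)
  also have "\<dots> = int (card A) + int (card B)"
    by (simp add: sum_of_bool_eq Int_def A_def B_def conj_commute)
  finally have "int (card {i \<in> sources. fst (source_pt i) + 1 \<le> c})
      - int (card {i \<in> sinks. fst (sink_pt i) \<le> c}) = int (card A) + int (card B)"
    using matching_sum[of ?g] by (simp add: sum_of_bool_eq Int_def right_def)
  moreover have "{i \<in> sources. fst (source_pt i) \<le> c} = {i \<in> sources. fst (source_pt i) + 1 \<le> c} \<union> S"
    "{i \<in> sources. fst (source_pt i) + 1 \<le> c} \<inter> S = {}"
    by (auto simp: S_def)
  then have "card {i \<in> sources. fst (source_pt i) \<le> c}
      = card {i \<in> sources. fst (source_pt i) + 1 \<le> c} + card S"
    by (metis (no_types, lifting) card_Un_disjoint finite_Un finite_sources finite_subset mem_Collect_eq subsetI)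
  moreover have "card (occ c) = card A + card B + card S"
  proof -
    have s: "snd ` source_pt ` S = {y. (c, y) \<in> V \<and> even (c + y) \<and> c + y \<noteq> 2 * (int K + int L) \<and> (c, y) \<notin> C}"
    proof -
      have "source_pt ` S = {v. fst v = c \<and> v \<in> source_pt ` sources}" by (auto simp: S_def)
      then show ?thesis unfolding uncovered_odds[symmetric] by (simp add: snd_image_column)
    qed
    have a: "snd ` A = {y. (c, y) \<in> C \<and> even (c + y) \<and> \<mu> (c, y) \<noteq> (c + 1, y)}"
    proof -
      have "A = {v. fst v = c \<and> (v \<in> C \<and> even (fst v + snd v) \<and> \<mu> v \<noteq> right v)}"
        unfolding A_def odds_def by blast
      then show ?thesis by (simp add: snd_image_column right_def)
    qed
    have b: "snd ` B = {y. (c + 1, y) \<in> C \<and> odd (c + y) \<and> \<mu> (c + 1, y) = (c, y)}"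
    proof -
      have "B = {v. fst v = c + 1 \<and> (v \<in> C \<and> even (fst v + snd v) \<and> \<mu> v = (fst v - 1, snd v))}"
        unfolding B_def odds_def by blast
      then show ?thesis by (auto simp: snd_image_column)
    qed
    have "snd ` B = {y. odd (c + y) \<and> (c, y) \<in> C \<and> \<mu> (c, y) = (c + 1, y)}"
      unfolding b using mu_in mu_mu by (auto; metis)
    moreover have "snd ` A \<union> snd ` source_pt ` S
        = {y. even (c + y) \<and> (c, y) \<in> V \<and> (c + 1, y) \<in> V \<and> \<not> ((c, y) \<in> C \<and> \<mu> (c, y) = (c + 1, y))}"
    proof -
      have "c + y \<noteq> 2 * (int K + int L) \<longleftrightarrow> (c + 1, y) \<in> V" if "(c, y) \<in> V" "even (c + y)" for y
        using odd_vertex_right[of c y] that by (auto simp: V_iff)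
      moreover have "c + y \<noteq> 2 * (int K + int L)" if "(c, y) \<in> C" for y using RT_notin that by blast
      ultimately show ?thesis unfolding s a using C_subset by blast
    qed
    ultimately have "occ c = (snd ` A \<union> snd ` source_pt ` S) \<union> snd ` B"
      by (auto simp: occ_def)
    moreover have "snd ` A \<inter> snd ` source_pt ` S = {}" "(snd ` A \<union> snd ` source_pt ` S) \<inter> snd ` B = {}"
      unfolding s a b by auto
    moreover have "card (snd ` A) = card A" "card (snd ` B) = card B" "card (snd ` source_pt ` S) = card S"
    proof -
      show "card (snd ` A) = card A" "card (snd ` B) = card B"
        by (auto intro!: card_image inj_onI simp: A_def B_def prod_eq_iff)
      have "card (snd ` source_pt ` S) = card (source_pt ` S)"
        by (intro card_image inj_onI) (auto simp: S_def prod_eq_iff)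
      then show "card (snd ` source_pt ` S) = card S" by (simp add: card_image inj_source_pt)
    qed
    ultimately show ?thesis using fin by (simp add: card_Un_disjoint)
  qed
  ultimately show ?thesis by simp
qed

section \<open>Ends and starts within a column, and tracing paths back\<close>

definition dying :: "int \<Rightarrow> int set" where
  "dying c = {y \<in> occ c. (c + 1, y) \<notin> C}"

text \<open>Only a reference edge can arrive at an uncovered vertex, which is therefore even;
  conversely the reference edge at a sink is no matching edge, so a path traverses it.\<close>

lemma dying_eq: "dying c = snd ` sink_pt ` {i \<in> sinks. fst (sink_pt i) = c + 1}"
proof -
  have "sink_pt ` {i \<in> sinks. fst (sink_pt i) = c + 1} = {v. fst v = c + 1 \<and> v \<in> sink_pt ` sinks}" by auto
  then have s: "snd ` sink_pt ` {i \<in> sinks. fst (sink_pt i) = c + 1} =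
      {y. (c + 1, y) \<in> V \<and> odd (c + 1 + y) \<and> c + 1 + y \<noteq> - 1 \<and> (c + 1, y) \<notin> C}"
    unfolding uncovered_evens[symmetric] by (simp add: snd_image_column)
  show ?thesis unfolding s
  proof (intro set_eqI iffI)
    fix y assume "y \<in> dying c"
    then have y: "y \<in> occ c" "(c + 1, y) \<notin> C" by (auto simp: dying_def)
    have "even (c + y)" using y mu_in[of "(c, y)"] by (auto simp: occ_def split: if_splits)
    moreover have "(c, y) \<in> V" "(c + 1, y) \<in> V" using occ_V y by auto
    moreover have "c + 1 + y \<noteq> -1" using calculation by (auto simp: V_iff)
    ultimately show "y \<in> {y. (c + 1, y) \<in> V \<and> odd (c + 1 + y) \<and> c + 1 + y \<noteq> - 1 \<and> (c + 1, y) \<notin> C}"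
      using y by auto
  next
    fix y assume "y \<in> {y. (c + 1, y) \<in> V \<and> odd (c + 1 + y) \<and> c + 1 + y \<noteq> - 1 \<and> (c + 1, y) \<notin> C}"
    then have y: "(c + 1, y) \<in> V" "odd (c + 1 + y)" "c + 1 + y \<noteq> - 1" "(c + 1, y) \<notin> C" by auto
    have "(c, y) \<in> V" using even_vertex_left[OF y(1-3)] by simp
    moreover have "\<not> ((c, y) \<in> C \<and> \<mu> (c, y) = (c + 1, y))" using mu_in[of "(c, y)"] y by auto
    ultimately show "y \<in> dying c" using y by (auto simp: dying_def occ_def)
  qed
qed

lemma card_dying: "card (dying c) = card {i \<in> sinks. fst (sink_pt i) = c + 1}"
proof -
  have "card (dying c) = card (sink_pt ` {i \<in> sinks. fst (sink_pt i) = c + 1})"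
    unfolding dying_eq by (intro card_image inj_onI) (auto simp: prod_eq_iff)
  then show ?thesis by (simp add: card_image inj_sink_pt)
qed

lemma card_surviving:
  "int (card {y \<in> occ c. (c + 1, y) \<in> C}) = int (card {i \<in> sources. fst (source_pt i) \<le> c})
      - int (card {i \<in> sinks. fst (sink_pt i) \<le> c + 1})"
proof -
  have "occ c = {y \<in> occ c. (c + 1, y) \<in> C} \<union> dying c" by (auto simp: dying_def)
  then have "card (occ c) = card {y \<in> occ c. (c + 1, y) \<in> C} + card (dying c)"
    by (metis (no_types, lifting) card_Un_disjoint disjoint_iff dying_def finite_Un finite_occ mem_Collect_eq)
  moreover have "{i \<in> sinks. fst (sink_pt i) \<le> c + 1}
      = {i \<in> sinks. fst (sink_pt i) \<le> c} \<union> {i \<in> sinks. fst (sink_pt i) = c + 1}" by auto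
  then have "card {i \<in> sinks. fst (sink_pt i) \<le> c + 1}
      = card {i \<in> sinks. fst (sink_pt i) \<le> c} + card {i \<in> sinks. fst (sink_pt i) = c + 1}"
    by (simp add: card_Un_disjoint disjoint_iff)
  ultimately show ?thesis using card_occ[of c] card_dying[of c] by simp
qed

text \<open>Sinks lie in the bottom row or on the lower right side
  \<open>x - y = 2 * (M + L) + 1\<close>, whose vertices are the lowest of their columns.\<close>

lemma dying_lowest:
  assumes "y \<in> dying c" "(c + 1, z) \<in> V" shows "y \<le> z"
proof -
  obtain i where i: "i \<in> sinks" "sink_pt i = (c + 1, y)"
    using assms(1) unfolding dying_eq by (force simp: prod_eq_iff)
  then show ?thesis using assms(2) by (auto simp: sink_pt_def V_iff split: if_splits)
qed

text \<open>An uncovered odd vertex on the upper left side or in the top row is the highest of its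
  column; the upper right side is ruled out because \<open>(c + 1, y)\<close> is still in the
  hexagon.\<close>

lemma born_highest:
  assumes "y \<in> occ c" "(c, y) \<notin> C" "(c, z) \<in> V" shows "z \<le> y"
proof -
  have y: "even (c + y)" "(c, y) \<in> V" "(c + 1, y) \<in> V"
    using assms(1,2) occ_V[OF assms(1)] by (auto simp: occ_def split: if_splits)
  then have "c + y \<noteq> 2 * (int K + int L)" by (auto simp: V_iff)
  then show ?thesis using uncovered_odd[of c y] y assms by (auto simp: V_iff)
qed

text \<open>The height in gap \<open>c - 1\<close> of the path that has height \<open>y\<close> in
  gap \<open>c\<close>. The path reaches an odd \<open>(c, y)\<close> from its partner, which is to
  the left or vertically adjacent, and an even one by the reference edge, at the same
  height.\<close>

definition prev :: "int \<Rightarrow> int \<Rightarrow> int" where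
  "prev c y = (if even (c + y) then snd (\<mu> (c, y)) else y)"

lemma prev_cases:
  assumes "y \<in> occ c" "(c, y) \<in> C"
  obtains "prev c y = y" "(c, y) \<in> C" | "even (c + y)" "prev c y = y + 1" "\<mu> (c, y) = (c, y + 1)"
  | "even (c + y)" "prev c y = y - 1" "\<mu> (c, y) = (c, y - 1)"
proof (cases "even (c + y)")
  case True
  show ?thesis using assms(2) by (rule mu_cases) (use True that assms in \<open>auto simp: prev_def occ_def\<close>)
next
  case False
  then show ?thesis using that assms by (auto simp: prev_def)
qed

lemma prev_occ:
  assumes y: "y \<in> occ c" "(c, y) \<in> C"
  shows "prev c y \<in> occ (c - 1)" "(c, prev c y) \<in> C"
proof -
  show C: "(c, prev c y) \<in> C" using y
    by (rule prev_cases) (use y mu_in[of "(c, y)"] in auto)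
  let ?z = "prev c y"
  show "?z \<in> occ (c - 1)"
  \<comment> \<open>\<open>(c, ?z)\<close> is the vertex where the path enters column
    \<open>c\<close>: if odd, by a matching edge from the left; if even, by its reference edge,
    which must then be shown not to be a matching edge as well.\<close>
  proof (cases "even (c + ?z)")
    case True
    then have ev: "even (c + y)" by (cases "even (c + y)") (auto simp: prev_def)
    then have ne: "\<mu> (c, y) \<noteq> (c + 1, y)" using y by (simp add: occ_def)
    from y(2) have "\<mu> (c, y) = (c - 1, y)"
      by (rule mu_cases) (use True ev ne in \<open>auto simp: prev_def\<close>)
    moreover have "?z = y" using ev calculation by (simp add: prev_def)
    moreover have "(c - 1, y) \<in> C" "\<mu> (c - 1, y) = (c, y)"
      using mu_in[OF y(2)] mu_mu[OF y(2)] calculation by auto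
    ultimately show ?thesis using ev by (auto simp: occ_def)
  next
    case False
    have "c + ?z \<noteq> -1" using LB_notin C by blast
    then have V: "(c - 1, ?z) \<in> V" "(c, ?z) \<in> V"
      using even_vertex_left[of c ?z] C C_subset False by auto
    have "\<mu> (c, ?z) \<noteq> (c - 1, ?z)"
    proof (cases "even (c + y)")
      case True
      with y have ne: "\<mu> (c, y) \<noteq> (c + 1, y)" by (auto simp: occ_def)
      from y(2) have "\<mu> (c, y) = (c, ?z)"
        by (rule mu_cases) (use True ne \<open>odd (c + ?z)\<close> in \<open>auto simp: prev_def\<close>)
      then show ?thesis using mu_mu[OF y(2)] by auto
    next
      case False
      then show ?thesis using y by (auto simp: prev_def occ_def)
    qed
    then have "\<not> ((c - 1, ?z) \<in> C \<and> \<mu> (c - 1, ?z) = (c, ?z))"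
      using mu_mu[of "(c - 1, ?z)"] by auto
    then show ?thesis using V False by (auto simp: occ_def)
  qed
qed

text \<open>Paths do not merge. After a vertical move the entered vertex is matched with
  \<open>(c, y)\<close>; without one, \<open>(c, y)\<close> is matched horizontally. So the entered
  vertex determines \<open>y\<close>.\<close>

lemma prev_inj:
  assumes y: "y \<in> occ c" "(c, y) \<in> C" and z: "z \<in> occ c" "(c, z) \<in> C" and eq: "prev c y = prev c z"
  shows "y = z"
proof -
  have *: "\<mu> (c, prev c y) = (c, y)" if "prev c y \<noteq> y" "y \<in> occ c" "(c, y) \<in> C" for y
    using that(2,3) by (rule prev_cases) (use that mu_mu[of "(c, y)"] in auto)
  have **: "\<mu> (c, y) \<noteq> (c, z)" if "prev c y = y" "y \<in> occ c" "(c, y) \<in> C" "y \<noteq> z" for y z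
    using that(3) by (rule mu_cases) (use that in \<open>auto simp: prev_def occ_def split: if_splits\<close>)
  show ?thesis
    using *[of y] *[of z] **[of y z] **[of z y] y z eq by (metis Pair_inject)
qed

end

section \<open>Two disjoint matchings\<close>

text \<open>Discrete integration: the increment at \<open>n\<close> counts the \<open>j\<close> with
  \<open>g j = n + 1\<close>, and for these \<open>f i \<le> n\<close> means
  \<open>f i < g j\<close>.\<close>

lemma sum_cumulative_times_increment:
  fixes f :: "'a \<Rightarrow> int" and g :: "'b \<Rightarrow> int"
  assumes "finite S" "finite T" "\<And>j. j \<in> T \<Longrightarrow> 1 \<le> g j \<and> g j \<le> int m"
  shows "(\<Sum>n<m. int (card {i \<in> S. f i \<le> int n}) *
            (int (card {j \<in> T. g j \<le> int n + 1}) - int (card {j \<in> T. g j \<le> int n})))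
       = (\<Sum>j\<in>T. int (card {i \<in> S. f i < g j}))"
  using assms(2,3)
proof (induction T rule: finite_induct)
  case empty
  then show ?case by simp
next
  case (insert j T)
  have ins: "int (card {k \<in> insert j T. g k \<le> c}) = int (card {k \<in> T. g k \<le> c}) + of_bool (g j \<le> c)" for c
  proof -
    have "{k \<in> insert j T. g k \<le> c} = (if g j \<le> c then insert j {k \<in> T. g k \<le> c} else {k \<in> T. g k \<le> c})"
      by auto
    then show ?thesis using insert.hyps by simp
  qed
  let ?F = "\<lambda>n. int (card {i \<in> S. f i \<le> int n})"
  define k where "k = nat (g j - 1)"
  have k: "g j = int k + 1" "k < m" using insert.prems[of j] by (auto simp: k_def)
  have "?F n * (of_bool (g j \<le> int n + 1) - of_bool (g j \<le> int n)) = (if n = k then ?F k else 0)" for n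
    using k by auto
  then have "(\<Sum>n<m. ?F n * (of_bool (g j \<le> int n + 1) - of_bool (g j \<le> int n))) = ?F k"
    using k(2) by simp
  also have "{i \<in> S. f i \<le> int k} = {i \<in> S. f i < g j}" using k(1) by auto
  finally have j: "(\<Sum>n<m. ?F n * (of_bool (g j \<le> int n + 1) - of_bool (g j \<le> int n)))
      = int (card {i \<in> S. f i < g j})" .
  have "(\<Sum>n<m. ?F n * (int (card {k \<in> insert j T. g k \<le> int n + 1}) - int (card {k \<in> insert j T. g k \<le> int n})))
      = (\<Sum>n<m. ?F n * (int (card {k \<in> T. g k \<le> int n + 1}) - int (card {k \<in> T. g k \<le> int n})))
        + (\<Sum>n<m. ?F n * (of_bool (g j \<le> int n + 1) - of_bool (g j \<le> int n)))"
    unfolding ins sum.distrib[symmetric] by (intro sum.cong) (auto simp: algebra_simps)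
  also have "\<dots> = (\<Sum>j\<in>T. int (card {i \<in> S. f i < g j})) + int (card {i \<in> S. f i < g j})"
    using insert.IH insert.prems j by simp
  finally show ?case using insert.hyps by simp
qed

text \<open>Here \<open>a\<close>, \<open>c\<close> will count starts and \<open>a'\<close>,
  \<open>c'\<close> ends of two families of paths, so a summand on the left counts pairs present at
  \<open>n\<close> of which at least one ends next. Besides the terms of the two sums on the right
  it contains \<open>a' n * c' n - a' (Suc n) * c' (Suc n)\<close>, which telescopes.\<close>

lemma telescope_products:
  fixes a a' c c' :: "nat \<Rightarrow> int"
  shows "(\<Sum>n<m. (a n - a' n) * (c n - c' n) - (a n - a' (Suc n)) * (c n - c' (Suc n)))
       = (\<Sum>n<m. a n * (c' (Suc n) - c' n)) + (\<Sum>n<m. c n * (a' (Suc n) - a' n))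
         - a' m * c' m + a' 0 * c' 0"
  by (induction m) (simp_all add: algebra_simps)

text \<open>Two edge-disjoint matchings, the second one given after the reflection
  \<open>(x, y) \<mapsto> (x, -1 - y)\<close>, which exchanges odd and even vertices.\<close>

locale hex_matching_pair =
  A: hex_matching K L M N C \<mu> + B: hex_matching "M + N - K" "K + L - N" N M C' \<mu>'
  for K L M N C \<mu> C' \<mu>' +
  assumes disjoint: "(x, y) \<in> C \<Longrightarrow> \<mu> (x, y) = (x', y') \<Longrightarrow> (x, - 1 - y) \<in> C' \<Longrightarrow>
    \<mu>' (x, - 1 - y) \<noteq> (x', - 1 - y')"
begin

lemma reflect_V: "(x, - 1 - y) \<in> B.V \<longleftrightarrow> (x, y) \<in> A.V"
  using A.KMN A.NKL by (auto simp: A.V_iff B.V_iff of_nat_diff)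

lemma reflect_V': "(x, - 1 - y) \<in> A.V \<longleftrightarrow> (x, y) \<in> B.V"
  using reflect_V[of x "- 1 - y"] by simp

definition shared :: "point set" where
  "shared = {(x, y). y \<in> A.occ x \<and> - 1 - y \<in> B.occ x}"

text \<open>Reflection exchanges parities, so an edge used by both families is a reference edge for
  one and, for the other, a matching edge traversed from its even end. For the latter its right end
  is an odd vertex matched to the left; \<open>?f\<close> records it there.\<close>

lemma card_shared: "card shared \<le> card A.left_edges + card B.left_edges"
proof -
  let ?f = "\<lambda>(x, y). if even (x + y) then Inr (x + 1, - 1 - y) else Inl (x + 1, y)
    :: point + point"
  have "?f ` shared \<subseteq> A.left_edges <+> B.left_edges"
  proof
    fix w assume "w \<in> ?f ` shared"
    then obtain x y where w: "w = ?f (x, y)" "y \<in> A.occ x" "- 1 - y \<in> B.occ x"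
      by (auto simp: shared_def)
    show "w \<in> A.left_edges <+> B.left_edges"
    proof (cases "even (x + y)")
      case True
      then have "odd (x + (- 1 - y))" by presburger
      then have *: "(x, - 1 - y) \<in> C'" "\<mu>' (x, - 1 - y) = (x + 1, - 1 - y)"
        using w(3) by (simp_all only: B.occ_def mem_Collect_eq if_False)
      have "even (x + 1 + (- 1 - y))" using True by presburger
      then have "(x + 1, - 1 - y) \<in> B.left_edges"
        using B.mu_in[OF *(1)] B.mu_mu[OF *(1)] *(2) by (auto simp: B.left_edges_def B.odds_def)
      then show ?thesis using True w(1) by auto
    next
      case False
      then have *: "(x, y) \<in> C" "\<mu> (x, y) = (x + 1, y)"
        using w(2) by (simp_all only: A.occ_def mem_Collect_eq if_False)
      have "even (x + 1 + y)" using False by presburger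
      then have "(x + 1, y) \<in> A.left_edges"
        using A.mu_in[OF *(1)] A.mu_mu[OF *(1)] *(2) by (auto simp: A.left_edges_def A.odds_def)
      then show ?thesis using False w(1) by auto
    qed
  qed
  moreover have "inj_on ?f shared" by (auto simp: inj_on_def split: if_splits)
  moreover have "finite A.left_edges" "finite B.left_edges"
    by (simp_all add: A.left_edges_def B.left_edges_def)
  ultimately have "card shared \<le> card (A.left_edges <+> B.left_edges)"
    by (intro card_inj_on_le) auto
  then show ?thesis using \<open>finite A.left_edges\<close> \<open>finite B.left_edges\<close> by (simp add: card_Plus)
qed

section \<open>Pairs of paths with a common gap\<close>

definition pairs :: "(int \<times> int \<times> int) set" where
  "pairs = (SIGMA x : UNIV. A.occ x \<times> B.occ x)"

text \<open>A blue and a red path with common gaps occur here exactly once, at the last of them, so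
  the cardinality is the number of such pairs of paths.\<close>

definition dying_pairs :: "(int \<times> int \<times> int) set" where
  "dying_pairs = {(x, p, q). p \<in> A.occ x \<and> q \<in> B.occ x \<and> ((x + 1, p) \<notin> C \<or> (x + 1, q) \<notin> C')}"

definition width :: nat where "width = Suc (2 * K + 2 * L + M + N)"

lemma occ_nonempty: "p \<in> A.occ x \<Longrightarrow> x \<in> int ` {..<width}"
  using A.occ_V[of p x] A.V_x_nonneg[of x p] A.V_x_le[of x p]
  by (intro image_eqI[of _ _ "nat x"]) (auto simp: width_def)

lemma finite_pairs: "finite pairs"
proof (rule finite_subset)
  show "pairs \<subseteq> (SIGMA x : int ` {..<width}. A.occ x \<times> B.occ x)"
    using occ_nonempty by (auto simp: pairs_def)
qed auto

text \<open>As \<open>q\<close> is a reflected height, \<open>p + q \<le> - 1\<close> says that red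
  is level with or above blue. Blue paths end at the lowest vertex of a column, red ones, before
  reflection, at the highest.\<close>

lemma dying_pairs_below:
  assumes "p \<in> A.occ x" "q \<in> B.occ x" "(x + 1, p) \<notin> C \<or> (x + 1, q) \<notin> C'"
  shows "p + q \<le> - 1"
  using assms(3)
proof
  assume "(x + 1, p) \<notin> C"
  then have "p \<in> A.dying x" using assms by (simp add: A.dying_def)
  moreover have "(x + 1, - 1 - q) \<in> A.V" using B.occ_V[OF assms(2)] by (simp add: reflect_V')
  ultimately show ?thesis using A.dying_lowest by force
next
  assume "(x + 1, q) \<notin> C'"
  then have "q \<in> B.dying x" using assms by (simp add: B.dying_def)
  moreover have "(x + 1, - 1 - p) \<in> B.V" using A.occ_V[OF assms(1)] by (simp add: reflect_V)
  ultimately show ?thesis using B.dying_lowest by force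
qed

text \<open>Dually, blue paths start at the highest vertex of a column and red ones, before
  reflection, at the lowest.\<close>

lemma born_pairs_above:
  assumes "p \<in> A.occ x" "q \<in> B.occ x" "(x, p) \<notin> C \<or> (x, q) \<notin> C'"
  shows "- 1 \<le> p + q"
  using assms(3)
proof
  assume "(x, p) \<notin> C"
  moreover have "(x, - 1 - q) \<in> A.V" using B.occ_V[OF assms(2)] by (simp add: reflect_V')
  ultimately show ?thesis using A.born_highest assms by force
next
  assume "(x, q) \<notin> C'"
  moreover have "(x, - 1 - p) \<in> B.V" using A.occ_V[OF assms(1)] by (simp add: reflect_V)
  ultimately show ?thesis using B.born_highest assms by force
qed

text \<open>Each height changes by at most 1 per gap, so \<open>p + q\<close> can pass from above
  \<open>- 1\<close> to below it only by dropping from 0 to \<open>- 2\<close>. Both paths would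
  then use the vertical edge between the heights \<open>p\<close> and \<open>p + 1\<close>, against
  disjointness.\<close>

lemma prev_below:
  assumes p: "p \<in> A.occ x" "(x, p) \<in> C" and q: "q \<in> B.occ x" "(x, q) \<in> C'" and "p + q < - 1"
  shows "A.prev x p + B.prev x q \<le> - 1"
proof (rule ccontr)
  assume gt: "\<not> ?thesis"
  have "A.prev x p \<le> p + 1 \<and> (A.prev x p = p + 1 \<longrightarrow> \<mu> (x, p) = (x, p + 1))"
    using p by (rule A.prev_cases) auto
  moreover have "B.prev x q \<le> q + 1 \<and> (B.prev x q = q + 1 \<longrightarrow> \<mu>' (x, q) = (x, q + 1))"
    using q by (rule B.prev_cases) auto
  ultimately have "p + q = - 2" and *: "\<mu> (x, p) = (x, p + 1)" "\<mu>' (x, q) = (x, q + 1)"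
    using gt assms(5) by auto
  then have "q = - 1 - (p + 1)" "q + 1 = - 1 - p" by auto
  then show False
    using disjoint[OF p(2) *(1)] B.mu_in[OF q(2)] B.mu_mu[OF q(2)] *(2) by metis
qed

text \<open>A pair in which the second path runs strictly above the first one was neither born at its
  column nor, as edges are disjoint, could it cross in one step from strictly below.\<close>

lemma card_dying_pairs_le: "card dying_pairs \<le> card shared"
proof -
  let ?less = "{(x, p, q) \<in> pairs. p + q < - 1}" and ?le = "{(x, p, q) \<in> pairs. p + q \<le> - 1}"
  let ?prev = "\<lambda>(x, p, q). (x - 1, A.prev x p, B.prev x q)"
  have cov: "(x, p) \<in> C \<and> (x, q) \<in> C'" if "(x, p, q) \<in> ?less" for x p q
    using that born_pairs_above[of p x q] by (force simp: pairs_def)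
  have sub: "dying_pairs \<subseteq> ?le"
    using dying_pairs_below by (auto simp: dying_pairs_def pairs_def)
  \<comment> \<open>The image pair lives on into gap \<open>x\<close>, so it is not dying.
    Injectivity then bounds \<open>?less\<close> by \<open>?le\<close> without
    \<open>dying_pairs\<close>, while \<open>?le\<close> exceeds \<open>?less\<close> by exactly the
    shared edges.\<close>
  have "?prev ` ?less \<subseteq> ?le - dying_pairs"
  proof
    fix w assume "w \<in> ?prev ` ?less"
    then obtain x p q where w: "w = ?prev (x, p, q)" "(x, p, q) \<in> ?less" by blast
    then have "p \<in> A.occ x" "q \<in> B.occ x" "p + q < - 1" "(x, p) \<in> C" "(x, q) \<in> C'"
      using cov by (auto simp: pairs_def)
    then show "w \<in> ?le - dying_pairs"
      using w(1) A.prev_occ[of p x] B.prev_occ[of q x] prev_below[of p x q]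
      by (auto simp: pairs_def dying_pairs_def)
  qed
  moreover have "inj_on ?prev ?less"
  proof (rule inj_onI)
    fix v w assume vw: "v \<in> ?less" "w \<in> ?less" "?prev v = ?prev w"
    obtain x p q x' p' q' where e: "v = (x, p, q)" "w = (x', p', q')" by (metis prod_cases3)
    have "x' = x" using vw(3) e by simp
    then show "v = w"
      using vw e cov[of x p q] cov[of x p' q'] A.prev_inj[of p x p'] B.prev_inj[of q x q']
      by (auto simp: pairs_def)
  qed
  moreover have fin: "finite ?le" "finite ?less"
    using finite_subset[OF _ finite_pairs] by (metis (no_types, lifting) mem_Collect_eq subsetI case_prodE)+
  ultimately have "card ?less \<le> card (?le - dying_pairs)"
    using card_inj_on_le by (metis (no_types, lifting) finite_Diff)
  moreover have "card (?le - dying_pairs) = card ?le - card dying_pairs" "card dying_pairs \<le> card ?le"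
    using sub fin by (auto intro: card_Diff_subset card_mono finite_subset)
  moreover have "card ?le = card ?less + card shared"
  proof -
    let ?eq = "(\<lambda>(x, y). (x, y, - 1 - y)) ` shared"
    have "?eq = {(x, p, q) \<in> pairs. q = - 1 - p}"
      by (auto simp: pairs_def shared_def)
    then have "?le = ?less \<union> ?eq" by auto
    moreover have "?less \<inter> ?eq = {}" by auto
    moreover have "card ?eq = card shared" by (intro card_image inj_onI) auto
    ultimately show ?thesis using fin by (metis (no_types, lifting) card_Un_disjoint finite_Un)
  qed
  ultimately show ?thesis by linarith
qed

lemma sink_column_bounds:
  "i \<in> A.sinks \<Longrightarrow> 1 \<le> fst (A.sink_pt i) \<and> fst (A.sink_pt i) \<le> int width"
  "i \<in> B.sinks \<Longrightarrow> 1 \<le> fst (B.sink_pt i) \<and> fst (B.sink_pt i) \<le> int width"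
  using A.KMN A.NKL
  by (auto simp: A.sinks_def B.sinks_def A.sink_pt_def B.sink_pt_def width_def of_nat_diff split: if_splits)

text \<open>Two paths have a common gap iff each starts strictly left of the end of the other, and
  at least one of these two conditions always holds. So adding the counts of both conditions and
  subtracting the number of all pairs leaves the pairs with a common gap.\<close>

lemma card_dying_pairs:
  "int (card dying_pairs) =
     (\<Sum>j\<in>B.sinks. int (card {i \<in> A.sources. fst (A.source_pt i) < fst (B.sink_pt j)}))
     + (\<Sum>j\<in>A.sinks. int (card {i \<in> B.sources. fst (B.source_pt i) < fst (A.sink_pt j)}))
     - int (card A.sinks) * int (card B.sinks)"
proof -
  define a where "a n = int (card {i \<in> A.sources. fst (A.source_pt i) \<le> int n})" for n
  define a' where "a' n = int (card {i \<in> A.sinks. fst (A.sink_pt i) \<le> int n})" for n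
  define c where "c n = int (card {i \<in> B.sources. fst (B.source_pt i) \<le> int n})" for n
  define c' where "c' n = int (card {i \<in> B.sinks. fst (B.sink_pt i) \<le> int n})" for n
  let ?SA = "\<lambda>x. {p \<in> A.occ x. (x + 1, p) \<in> C}" and ?SB = "\<lambda>x. {q \<in> B.occ x. (x + 1, q) \<in> C'}"
  have "{i \<in> A.sinks. fst (A.sink_pt i) \<le> int width} = A.sinks"
    "{i \<in> B.sinks. fst (B.sink_pt i) \<le> int width} = B.sinks"
    using sink_column_bounds by auto
  then have total: "a' width = int (card A.sinks)" "c' width = int (card B.sinks)"
    by (simp_all add: a'_def c'_def)
  have "dying_pairs = (SIGMA x : int ` {..<width}. A.occ x \<times> B.occ x - ?SA x \<times> ?SB x)"
    using occ_nonempty by (auto simp: dying_pairs_def)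
  then have "card dying_pairs = (\<Sum>n<width. card (A.occ (int n) \<times> B.occ (int n) - ?SA (int n) \<times> ?SB (int n)))"
    by (simp add: card_SigmaI sum.reindex)
  then have "int (card dying_pairs)
      = (\<Sum>n<width. int (card (A.occ (int n) \<times> B.occ (int n) - ?SA (int n) \<times> ?SB (int n))))"
    by simp
  also have "\<dots> = (\<Sum>n<width. (a n - a' n) * (c n - c' n) - (a n - a' (Suc n)) * (c n - c' (Suc n)))"
  proof (rule sum.cong[OF refl])
    fix n
    let ?x = "int n"
    have sub: "?SA ?x \<times> ?SB ?x \<subseteq> A.occ ?x \<times> B.occ ?x" by auto
    then have "card (?SA ?x \<times> ?SB ?x) \<le> card (A.occ ?x \<times> B.occ ?x)" by (intro card_mono) auto
    moreover have "card (A.occ ?x \<times> B.occ ?x - ?SA ?x \<times> ?SB ?x)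
        = card (A.occ ?x \<times> B.occ ?x) - card (?SA ?x \<times> ?SB ?x)"
      using sub by (intro card_Diff_subset) auto
    ultimately have "int (card (A.occ ?x \<times> B.occ ?x - ?SA ?x \<times> ?SB ?x))
        = int (card (A.occ ?x \<times> B.occ ?x)) - int (card (?SA ?x \<times> ?SB ?x))"
      by (simp only: of_nat_diff)
    also have "\<dots> = int (card (A.occ ?x)) * int (card (B.occ ?x)) - int (card (?SA ?x)) * int (card (?SB ?x))"
      by (simp add: card_cartesian_product)
    also have "\<dots> = (a n - a' n) * (c n - c' n) - (a n - a' (Suc n)) * (c n - c' (Suc n))"
      unfolding A.card_occ B.card_occ A.card_surviving B.card_surviving a_def a'_def c_def c'_def
      by (simp add: add.commute)
    finally show "int (card (A.occ ?x \<times> B.occ ?x - ?SA ?x \<times> ?SB ?x))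
        = (a n - a' n) * (c n - c' n) - (a n - a' (Suc n)) * (c n - c' (Suc n))" .
  qed
  also have "\<dots> = (\<Sum>n<width. a n * (c' (Suc n) - c' n)) + (\<Sum>n<width. c n * (a' (Suc n) - a' n))
      - a' width * c' width + a' 0 * c' 0"
    by (rule telescope_products)
  also have "(\<Sum>n<width. a n * (c' (Suc n) - c' n))
      = (\<Sum>j\<in>B.sinks. int (card {i \<in> A.sources. fst (A.source_pt i) < fst (B.sink_pt j)}))"
    unfolding a_def c'_def
    using sum_cumulative_times_increment[of A.sources B.sinks "\<lambda>j. fst (B.sink_pt j)" width
        "\<lambda>i. fst (A.source_pt i)"] sink_column_bounds by (simp add: add.commute)
  also have "(\<Sum>n<width. c n * (a' (Suc n) - a' n))
      = (\<Sum>j\<in>A.sinks. int (card {i \<in> B.sources. fst (B.source_pt i) < fst (A.sink_pt j)}))"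
    unfolding c_def a'_def
    using sum_cumulative_times_increment[of B.sources A.sinks "\<lambda>j. fst (A.sink_pt j)" width
        "\<lambda>i. fst (B.source_pt i)"] sink_column_bounds by (simp add: add.commute)
  \<comment> \<open>No sink lies in column 0, so the boundary term at 0 vanishes.\<close>
  also have "a' 0 = 0"
    using sink_column_bounds(1) by (fastforce simp: a'_def)
  finally show ?thesis using total by simp
qed

lemma excess_bound:
  "(\<Sum>j\<in>B.sinks. int (card {i \<in> A.sources. fst (A.source_pt i) < fst (B.sink_pt j)}))
     + (\<Sum>j\<in>A.sinks. int (card {i \<in> B.sources. fst (B.source_pt i) < fst (A.sink_pt j)}))
     - int (card A.sinks) * int (card B.sinks)
   \<le> (int (\<Sum>A.sinks) - int (\<Sum>A.sources)) + (int (\<Sum>B.sinks) - int (\<Sum>B.sources))"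
  using card_dying_pairs card_dying_pairs_le card_shared A.sum_indices B.sum_indices by linarith

end

section \<open>From index sums to inversions of the boundary words\<close>

lemma (in hex_matching_pair) boundary_words:
  assumes "length lT = K" "length t = L" "length rT = M"
    and "length rB = N" "length b = K + L - N" "length lB = M + N - K"
    and src: "A.sources = zeros (lT @ t)" "B.sources = ones (lB @ b)"
    and snk: "A.sinks = zeros (b @ rB)" "B.sinks = ones (t @ rT)"
  shows "(count_list lT 0 + count_list t 0 = count_list rB 0 + count_list b 0 \<and>
          count_list t 1 + count_list rT 1 = count_list b 1 + count_list lB 1) \<and>
         (word_le (lT @ t) (b @ rB) \<and> word_le (t @ rT) (lB @ b)) \<and>
         inversions rB + inversions b + inversions lB \<ge>
           inversions lT + inversions t + inversions rT
           + count_list lT 1 * count_list t 0 + count_list t 1 * count_list rT 0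
           + count_list rB 0 * count_list lB 1"
proof (intro conjI)
  note len = assms(1-6)
  have KN: "K \<le> M + N" "N \<le> K + L" using A.KMN A.NKL by auto
  have blue: "count_list lT 0 + count_list t 0 = count_list b 0 + count_list rB 0"
    using A.card_sources unfolding src snk card_zeros by simp
  have red: "count_list lB 1 + count_list b 1 = count_list t 1 + count_list rT 1"
    using B.card_sources unfolding src snk card_ones by simp
  show "count_list lT 0 + count_list t 0 = count_list rB 0 + count_list b 0"
    "count_list t 1 + count_list rT 1 = count_list b 1 + count_list lB 1"
    using blue red by simp_all
  show "word_le (lT @ t) (b @ rB)"
  proof (rule word_leI_zeros)
    show "card {i \<in> zeros (b @ rB). i < m} \<le> card {i \<in> zeros (lT @ t). i < m}" for m
      using A.card_prefix[of m] unfolding src snk .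
  qed (use len KN blue in auto)
  show "word_le (t @ rT) (lB @ b)"
  proof (rule word_leI_ones)
    show "card {i \<in> ones (t @ rT). i < m} \<le> card {i \<in> ones (lB @ b). i < m}" for m
      using B.card_prefix[of m] unfolding src snk .
  qed (use len KN red in auto)
  \<comment> \<open>Equal numbers of zeros make the triangular terms cancel.\<close>
  have B: "int (\<Sum>A.sinks) - int (\<Sum>A.sources) = int (inversions (b @ rB)) - int (inversions (lT @ t))"
    using inversions_plus_triangle[of "b @ rB"] inversions_plus_triangle[of "lT @ t"] blue
    unfolding src snk by (simp del: of_nat_sum)
  \<comment> \<open>Red indices are positions of ones. As the lengths agree, passing from ones to
    zeros reverses the sign of the difference of index sums.\<close>
  have R: "int (\<Sum>B.sinks) - int (\<Sum>B.sources) = int (inversions (lB @ b)) - int (inversions (t @ rT))"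
  proof -
    have "length (lB @ b) = length (t @ rT)" using len KN by simp
    moreover have "count_list (lB @ b) 0 = count_list (t @ rT) 0"
      using calculation red count_zero_plus_one[of "lB @ b"] count_zero_plus_one[of "t @ rT"] by simp
    ultimately show ?thesis
      using inversions_plus_triangle[of "lB @ b"] inversions_plus_triangle[of "t @ rT"]
        sum_zeros_ones[of "lB @ b"] sum_zeros_ones[of "t @ rT"]
      unfolding src snk by (simp del: of_nat_sum)
  qed
  have compl: "(\<Sum>j\<in>T. int (card {i \<in> S. f i < g j}))
      = int (card S) * int (card T) - int (card {(j, i). j \<in> T \<and> i \<in> S \<and> g j \<le> f i})"
    if "finite S" "finite T" for S T :: "nat set" and f g :: "nat \<Rightarrow> int"
  proof -
    have "int (card {i \<in> S. f i < g j}) = int (card S) - int (card {i \<in> S. g j \<le> f i})" for j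
    proof -
      have "S = {i \<in> S. f i < g j} \<union> {i \<in> S. g j \<le> f i}" by auto
      moreover have "{i \<in> S. f i < g j} \<inter> {i \<in> S. g j \<le> f i} = {}" by auto
      ultimately have "card S = card {i \<in> S. f i < g j} + card {i \<in> S. g j \<le> f i}"
        by (metis (no_types, lifting) card_Un_disjoint finite_Un that(1))
      then show ?thesis by simp
    qed
    moreover have "{(j, i). j \<in> T \<and> i \<in> S \<and> g j \<le> f i} = (SIGMA j : T. {i \<in> S. g j \<le> f i})" by auto
    ultimately show ?thesis using that by (simp add: card_SigmaI sum_subtractf)
  qed
  \<comment> \<open>A blue start can lie at or to the right of a red end only if both are in the top
    row. A common position would carry two different letters, so the pairs are the inversions of
    \<open>t\<close>.\<close>
  have top: "card {(j, i). j \<in> B.sinks \<and> i \<in> A.sources \<and> fst (B.sink_pt j) \<le> fst (A.source_pt i)}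
      = inversions t"
  proof -
    let ?I = "{(j, i). j < i \<and> i < length t \<and> t ! j = 1 \<and> t ! i = 0}"
    have "fst (B.sink_pt j) \<le> fst (A.source_pt i) \<longleftrightarrow> j < L \<and> K \<le> i \<and> j \<le> i - K"
      if "i < K + L" for i j
      using KN that by (auto simp: B.sink_pt_def A.source_pt_def of_nat_diff)
    then have "{(j, i). j \<in> B.sinks \<and> i \<in> A.sources \<and> fst (B.sink_pt j) \<le> fst (A.source_pt i)}
        = {(j, i). i < K + L \<and> j \<in> B.sinks \<and> i \<in> A.sources \<and> j < L \<and> K \<le> i \<and> j \<le> i - K}"
      by (auto simp: A.sources_def)
    also have "\<dots> = (\<lambda>(j, i). (j, K + i)) ` ?I"
    proof (intro set_eqI iffI; clarify)
      fix j i assume "i < K + L" "j \<in> B.sinks" "i \<in> A.sources" "j < L" "K \<le> i" "j \<le> i - K"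
      then have "t ! j = 1" "t ! (i - K) = 0"
        using len by (auto simp: src snk zeros_def ones_def nth_append)
      moreover from this have "j \<noteq> i - K" by auto
      ultimately show "(j, i) \<in> (\<lambda>(j, i). (j, K + i)) ` ?I"
        using \<open>i < K + L\<close> \<open>K \<le> i\<close> \<open>j \<le> i - K\<close> len by (intro image_eqI[of _ _ "(j, i - K)"]) auto
    next
      fix j i assume "j < i" "i < length t" "t ! j = 1" "t ! i = 0"
      then show "K + i < K + L \<and> j \<in> B.sinks \<and> K + i \<in> A.sources \<and> j < L \<and> K \<le> K + i \<and> j \<le> K + i - K"
        using len by (auto simp: src snk zeros_def ones_def nth_append)
    qed
    also have "card \<dots> = card ?I" by (intro card_image) (auto simp: inj_on_def)
    finally show ?thesis by (simp add: inversions_def)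
  qed
  \<comment> \<open>In the bottom row a blue end to the left of a red start is a 0 before a 1 in
    \<open>b\<close>, a non-inversion.\<close>
  have bottom: "card {(j, i). j \<in> A.sinks \<and> i \<in> B.sources \<and> fst (A.sink_pt j) \<le> fst (B.source_pt i)}
      + inversions b = count_list b 0 * count_list b 1"
  proof -
    let ?s = "M + N - K"
    let ?I = "{(j, i). j < i \<and> j \<in> zeros b \<and> i \<in> ones b}"
    have "fst (A.sink_pt j) \<le> fst (B.source_pt i) \<longleftrightarrow> j < K + L - N \<and> ?s \<le> i \<and> j \<le> i - ?s"
      if "i < ?s + (K + L - N)" for i j
      using KN that by (auto simp: A.sink_pt_def B.source_pt_def of_nat_diff)
    then have "{(j, i). j \<in> A.sinks \<and> i \<in> B.sources \<and> fst (A.sink_pt j) \<le> fst (B.source_pt i)}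
        = {(j, i). i < ?s + (K + L - N) \<and> j \<in> A.sinks \<and> i \<in> B.sources \<and> j < K + L - N \<and> ?s \<le> i \<and> j \<le> i - ?s}"
      by (auto simp: B.sources_def)
    also have "\<dots> = (\<lambda>(j, i). (j, ?s + i)) ` ?I"
    proof (intro set_eqI iffI; clarify)
      fix j i assume *: "i < ?s + (K + L - N)" "j \<in> A.sinks" "i \<in> B.sources" "j < K + L - N" "?s \<le> i" "j \<le> i - ?s"
      then have "i - ?s < K + L - N" by linarith
      then have "j \<in> zeros b" "i - ?s \<in> ones b"
        using * len by (auto simp: src snk zeros_def ones_def nth_append)
      moreover from this have "j \<noteq> i - ?s" by (auto simp: zeros_def ones_def)
      ultimately show "(j, i) \<in> (\<lambda>(j, i). (j, ?s + i)) ` ?I"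
        using * len by (intro image_eqI[of _ _ "(j, i - ?s)"]) auto
    next
      fix j i assume "j < i" "j \<in> zeros b" "i \<in> ones b"
      then show "?s + i < ?s + (K + L - N) \<and> j \<in> A.sinks \<and> ?s + i \<in> B.sources \<and> j < K + L - N
          \<and> ?s \<le> ?s + i \<and> j \<le> ?s + i - ?s"
        using len by (auto simp: src snk zeros_def ones_def nth_append)
    qed
    also have "card \<dots> = card ?I" by (intro card_image) (auto simp: inj_on_def)
    finally show ?thesis using inversions_compl[of b] by simp
  qed
  let ?r = "int (card B.sinks)" and ?b = "int (card A.sinks)"
  have cards: "?r = int (count_list b 1) + int (count_list lB 1)"
    "?b = int (count_list b 0) + int (count_list rB 0)"
    using red unfolding snk card_zeros card_ones by simp_all
  have "?r * ?b - int (inversions t) - (int (count_list b 0) * int (count_list b 1) - int (inversions b))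
      \<le> (int (\<Sum>A.sinks) - int (\<Sum>A.sources)) + (int (\<Sum>B.sinks) - int (\<Sum>B.sources))"
  proof -
    have *: "int (card {(j, i). j \<in> A.sinks \<and> i \<in> B.sources \<and> fst (A.sink_pt j) \<le> fst (B.source_pt i)})
        = int (count_list b 0) * int (count_list b 1) - int (inversions b)"
      using arg_cong[OF bottom, of int] by simp
    have "(\<Sum>j\<in>B.sinks. int (card {i \<in> A.sources. fst (A.source_pt i) < fst (B.sink_pt j)}))
        = ?r * ?b - int (inversions t)"
      using compl[OF A.finite_sources B.finite_sinks,
          where f = "\<lambda>i. fst (A.source_pt i)" and g = "\<lambda>j. fst (B.sink_pt j)"] unfolding top A.card_sources by (simp only: mult.commute)
    moreover have "(\<Sum>j\<in>A.sinks. int (card {i \<in> B.sources. fst (B.source_pt i) < fst (A.sink_pt j)}))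
        = ?r * ?b - (int (count_list b 0) * int (count_list b 1) - int (inversions b))"
      using compl[OF B.finite_sources A.finite_sinks,
          where f = "\<lambda>i. fst (B.source_pt i)" and g = "\<lambda>j. fst (A.sink_pt j)"] unfolding * B.card_sources .
    ultimately show ?thesis
      using excess_bound mult.commute[of ?b ?r] by linarith
  qed
  \<comment> \<open>The products of \<open>|b|_1\<close> with \<open>|r_B|_0\<close> and of
    \<open>|l_B|_1\<close> with \<open>|b|_0\<close> cancel against the cross terms of
    \<open>inversions_append\<close>, and one copy each of \<open>d(t)\<close> and
    \<open>d(b)\<close> cancels.\<close>
  then have "int (inversions lT + inversions t + inversions rT + count_list lT 1 * count_list t 0
      + count_list t 1 * count_list rT 0 + count_list rB 0 * count_list lB 1)
      \<le> int (inversions rB + inversions b + inversions lB)"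
    unfolding B R cards inversions_append by (simp add: algebra_simps)
  then show "inversions lT + inversions t + inversions rT + count_list lT 1 * count_list t 0
      + count_list t 1 * count_list rT 0 + count_list rB 0 * count_list lB 1
      \<le> inversions rB + inversions b + inversions lB"
    by linarith
qed

section \<open>The matchings of a configuration\<close>

locale hfpl_configuration =
  fixes K L M N :: nat and f :: "point set set"
  assumes KMN: "K \<le> M + N" and NKL: "N \<le> K + L" and MN: "1 \<le> M + N"
    and hfpl: "hfpl K L M N f"
begin

abbreviation "V \<equiv> hex_verts K L M N"
abbreviation "LT \<equiv> LT_set K"
abbreviation "LB \<equiv> LB_set K M N"
abbreviation "RT \<equiv> RT_set K L M"
abbreviation "RB \<equiv> RB_set K L M N"
abbreviation "T \<equiv> T_set K L"
abbreviation "B \<equiv> B_set K L M N"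

lemma f_subset: "f \<subseteq> hex_edges K L M N" using hfpl by (simp add: hfpl_def)

lemma finite_f: "finite f" using f_subset finite_hex_edges finite_subset by blast

lemma degree_sides: "v \<in> LB \<union> LT \<union> RB \<union> RT \<Longrightarrow> degree f v = 0 \<or> degree f v = 1"
  using hfpl unfolding hfpl_def by blast

lemma degree_TB: "v \<in> T \<union> B \<Longrightarrow> degree f v = 1"
  using hfpl unfolding hfpl_def by blast

lemma degree_inner: "v \<in> V \<Longrightarrow> v \<notin> LB \<union> LT \<union> RB \<union> RT \<union> T \<union> B \<Longrightarrow> degree f v = 2"
  using hfpl unfolding hfpl_def by blast

lemma edge_V: "{u, v} \<in> f \<Longrightarrow> u \<in> V"
  by (rule hex_edgesD(1)[OF subsetD[OF f_subset]])

lemma degree_pos_V: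
  assumes "0 < degree f v" shows "v \<in> V"
proof -
  have "\<exists>u v. u \<noteq> v \<and> e = {u, v}" if "e \<in> f" for e
    using hex_edges_parity[of e K L M N] f_subset that by (metis subsetD)
  then obtain z where "{v, z} \<in> f" using degree_pos_neighbour[OF finite_f _ assms] by metis
  then show ?thesis by (rule edge_V)
qed

lemma degree_le_2: "degree f v \<le> 2"
proof (cases "0 < degree f v")
  case True
  then have "v \<in> V" by (rule degree_pos_V)
  then show ?thesis using degree_sides[of v] degree_TB[of v] degree_inner[of v] by fastforce
qed simp

lemma degree_1_cases:
  assumes "degree f v = 1"
  shows "v \<in> LB \<union> LT \<or> v \<in> RB \<union> RT \<or> (\<exists>i\<in>{1..L}. v = T_pt K i) \<or> (\<exists>i\<in>{1..K + L - N}. v = B_pt K M N i)"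
proof -
  have "v \<in> V" using assms degree_pos_V by simp
  then have "v \<in> LB \<union> LT \<union> RB \<union> RT \<union> T \<union> B" using degree_inner assms by fastforce
  then show ?thesis by (auto simp: T_set_def B_set_def)
qed

text \<open>Parity and ranges of \<open>x + y\<close> tell the six families apart:
  \<open>LT\<close>, \<open>T\<close>, \<open>RT\<close> are odd vertices in increasing order of
  \<open>x + y\<close>, and \<open>LB\<close>, \<open>B\<close>, \<open>RB\<close> even
  ones.\<close>

lemma boundary_sums:
  "v \<in> LT \<longrightarrow> even (fst v + snd v) \<and> 0 \<le> fst v + snd v \<and> fst v + snd v < 2 * int K"
  "v \<in> LB \<longrightarrow> odd (fst v + snd v) \<and> fst v + snd v = - 1"
  "v \<in> RT \<longrightarrow> even (fst v + snd v) \<and> fst v + snd v = 2 * (int K + int L)"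
  "v \<in> RB \<longrightarrow> odd (fst v + snd v) \<and> 2 * (int K + int L - int N) < fst v + snd v"
  by (auto simp: LT_set_def LT_pt_def LB_set_def LB_pt_def RT_set_def RT_pt_def RB_set_def RB_pt_def)

lemma T_pt_sum: "fst (T_pt K i) + snd (T_pt K i) = 2 * (int K - 1 + int i)"
  by (auto simp: T_pt_def)

lemma B_pt_sum: "fst (B_pt K M N i) + snd (B_pt K M N i) = 2 * int i - 1"
  by (auto simp: B_pt_def Let_def)

lemma boundary_disjoint:
  "v \<in> LT \<union> LB \<Longrightarrow> v \<notin> RT \<union> RB"
  "i \<in> {1..L} \<Longrightarrow> T_pt K i \<notin> LT \<union> LB \<union> RT \<union> RB"
  "i \<in> {1..K + L - N} \<Longrightarrow> B_pt K M N i \<notin> LT \<union> LB \<union> RT \<union> RB"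
  "T_pt K i \<noteq> B_pt K M N j"
proof -
  show "v \<notin> RT \<union> RB" if "v \<in> LT \<union> LB"
  proof -
    define s where "s = fst v + snd v"
    show ?thesis using that boundary_sums[of v, folded s_def] NKL by auto
  qed
  show "T_pt K i \<notin> LT \<union> LB \<union> RT \<union> RB" if i: "i \<in> {1..L}"
    using i boundary_sums[of "T_pt K i"] NKL unfolding T_pt_sum by auto
  show "B_pt K M N i \<notin> LT \<union> LB \<union> RT \<union> RB" if i: "i \<in> {1..K + L - N}"
    using i boundary_sums[of "B_pt K M N i"] NKL unfolding B_pt_sum by auto
  have "even (fst (T_pt K i) + snd (T_pt K i))" "odd (fst (B_pt K M N j) + snd (B_pt K M N j))"
    unfolding T_pt_sum B_pt_sum by simp_all
  then show "T_pt K i \<noteq> B_pt K M N j" by metis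
qed

lemma T_pt_inj: "T_pt K i = T_pt K j \<longleftrightarrow> i = j" by (auto simp: T_pt_def)

lemma B_pt_inj: "B_pt K M N i = B_pt K M N j \<longleftrightarrow> i = j" by (auto simp: B_pt_def Let_def)

section \<open>The starting ends of the paths of a configuration\<close>

text \<open>The condition for letter 0 of \<open>t\<close>, as \<open>B_source\<close> is the one
  for letter 0 of \<open>b\<close>: a zero marks an end in the top row but a start in the bottom
  row.\<close>

definition T_sink :: "nat \<Rightarrow> bool" where
  "T_sink i \<longleftrightarrow> (\<exists>v \<in> LT \<union> LB \<union> B. path_connected f (T_pt K i) v) \<or>
                 (\<exists>h \<in> {1..<i}. path_connected f (T_pt K i) (T_pt K h))"

definition B_source :: "nat \<Rightarrow> bool" where
  "B_source i \<longleftrightarrow> (\<exists>v \<in> RT \<union> RB \<union> T. path_connected f (B_pt K M N i) v) \<or>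
                 (\<exists>j \<in> {i<..K + L - N}. path_connected f (B_pt K M N i) (B_pt K M N j))"

definition start_pts :: "point set" where
  "start_pts = LT \<union> LB \<union> T_pt K ` {i \<in> {1..L}. \<not> T_sink i} \<union> B_pt K M N ` {i \<in> {1..K + L - N}. B_source i}"

lemma start_pts_iff:
  "v \<in> LT \<union> LB \<Longrightarrow> v \<in> start_pts"
  "v \<in> RT \<union> RB \<Longrightarrow> v \<notin> start_pts"
  "i \<in> {1..L} \<Longrightarrow> T_pt K i \<in> start_pts \<longleftrightarrow> \<not> T_sink i"
  "i \<in> {1..K + L - N} \<Longrightarrow> B_pt K M N i \<in> start_pts \<longleftrightarrow> B_source i"
proof -
  show "v \<in> LT \<union> LB \<Longrightarrow> v \<in> start_pts" by (auto simp: start_pts_def)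
  show "v \<in> RT \<union> RB \<Longrightarrow> v \<notin> start_pts"
    using boundary_disjoint(1-3) unfolding start_pts_def by blast
  show "T_pt K i \<in> start_pts \<longleftrightarrow> \<not> T_sink i" if i: "i \<in> {1..L}"
  proof -
    have "T_pt K i \<notin> B_pt K M N ` X" for X using boundary_disjoint(4)[of i] by fast
    then show ?thesis
      using boundary_disjoint(2)[OF i] i unfolding start_pts_def Un_iff image_iff T_pt_inj by blast
  qed
  show "B_pt K M N i \<in> start_pts \<longleftrightarrow> B_source i" if i: "i \<in> {1..K + L - N}"
  proof -
    have "B_pt K M N i \<notin> T_pt K ` X" for X using boundary_disjoint(4)[of _ i] by (metis imageE)
    then show ?thesis
      using boundary_disjoint(3)[OF i] i unfolding start_pts_def Un_iff image_iff B_pt_inj by blast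
  qed
qed

text \<open>Side vertices may have degree 0, but a path to \<open>w\<close> from another vertex
  excludes this, so \<open>w\<close> has degree 1 and is the other end.\<close>

lemma end_unique:
  assumes "degree f u = 1" "degree f v = 1" "u \<noteq> v" "path_connected f u v"
    and "path_connected f u w" "w \<noteq> u" "w \<in> LT \<union> LB \<union> RT \<union> RB \<union> T \<union> B"
  shows "w = v"
proof -
  have "0 < degree f w"
    using path_connected_degree_pos[OF finite_f path_connected_sym] assms by blast
  then have "degree f w = 1" using degree_sides[of w] degree_TB[of w] assms(7) by fastforce
  then show ?thesis using path_end_unique[OF finite_f degree_le_2] assms by metis
qed

text \<open>The existential conditions can be tested at \<open>v\<close> alone, the only other
  distinguished vertex connected with \<open>T_pt K i\<close>.\<close>

lemma T_sink_iff:
  assumes i: "i \<in> {1..L}" and v: "degree f v = 1" "T_pt K i \<noteq> v" "path_connected f (T_pt K i) v"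
  shows "T_sink i \<longleftrightarrow> v \<in> LT \<union> LB \<union> B \<or> (\<exists>h\<in>{1..<i}. v = T_pt K h)"
proof -
  have d: "degree f (T_pt K i) = 1" using i degree_TB by (auto simp: T_set_def)
  have ni: "T_pt K i \<notin> LT \<union> LB \<union> B"
    using boundary_disjoint(2)[OF i] boundary_disjoint(4)[of i] by (auto simp: B_set_def)
  have T: "h \<in> {1..<i} \<Longrightarrow> T_pt K h \<in> T \<and> T_pt K h \<noteq> T_pt K i" for h
    using i by (auto simp: T_set_def T_pt_inj)
  note u = end_unique[OF d v]
  show ?thesis
  proof
    assume "T_sink i"
    then show "v \<in> LT \<union> LB \<union> B \<or> (\<exists>h\<in>{1..<i}. v = T_pt K h)"
      unfolding T_sink_def using u ni T by (metis UnCI UnE)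
  qed (use v in \<open>auto simp: T_sink_def\<close>)
qed

lemma B_source_iff:
  assumes i: "i \<in> {1..K + L - N}" and v: "degree f v = 1" "B_pt K M N i \<noteq> v" "path_connected f (B_pt K M N i) v"
  shows "B_source i \<longleftrightarrow> v \<in> RT \<union> RB \<union> T \<or> (\<exists>j\<in>{i<..K + L - N}. v = B_pt K M N j)"
proof -
  have d: "degree f (B_pt K M N i) = 1" using i degree_TB by (auto simp: B_set_def)
  have ni: "B_pt K M N i \<notin> RT \<union> RB \<union> T"
    using boundary_disjoint(3)[OF i] boundary_disjoint(4)[of _ i] by (auto simp: T_set_def; metis)
  have T: "h \<in> {i<..K + L - N} \<Longrightarrow> B_pt K M N h \<in> B \<and> B_pt K M N h \<noteq> B_pt K M N i" for h
    using i by (auto simp: B_set_def B_pt_inj)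
  note u = end_unique[OF d v]
  show ?thesis
  proof
    assume "B_source i"
    then show "v \<in> RT \<union> RB \<union> T \<or> (\<exists>j\<in>{i<..K + L - N}. v = B_pt K M N j)"
      unfolding B_source_def using u ni T by (metis UnCI UnE)
  qed (use v in \<open>auto simp: B_source_def\<close>)
qed

lemma T_start_iff:
  assumes i: "i \<in> {1..L}" and v: "degree f v = 1" "T_pt K i \<noteq> v" "path_connected f (T_pt K i) v"
  shows "T_pt K i \<in> start_pts \<longleftrightarrow> v \<in> RT \<union> RB \<or> (\<exists>h\<in>{i<..L}. v = T_pt K h)"
proof -
  have "v \<in> LT \<union> LB \<union> B \<or> (\<exists>h\<in>{1..<i}. v = T_pt K h) \<longleftrightarrow> \<not> (v \<in> RT \<union> RB \<or> (\<exists>h\<in>{i<..L}. v = T_pt K h))"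
  proof -
    consider "v \<in> LB \<union> LT" | "v \<in> RB \<union> RT" | h where "h \<in> {1..L}" "v = T_pt K h"
      | j where "j \<in> {1..K + L - N}" "v = B_pt K M N j"
      using degree_1_cases[OF v(1)] by blast
    then show ?thesis
    proof cases
      case 1
      then show ?thesis using boundary_disjoint(1)[of v] boundary_disjoint(2) i by fastforce
    next
      case 2
      then show ?thesis using boundary_disjoint(1)[of v] boundary_disjoint(2,3) i
        by (fastforce simp: B_set_def)
    next
      case 3
      then have "h < i \<or> i < h" using v(2) by (metis linorder_neqE_nat)
      moreover have "v \<notin> LT \<union> LB \<union> RT \<union> RB \<union> B"
        using 3 boundary_disjoint(2)[of h] boundary_disjoint(4)[of h] by (auto simp: B_set_def)
      moreover have "(\<exists>k\<in>{1..<i}. v = T_pt K k) \<longleftrightarrow> h < i" "(\<exists>k\<in>{i<..L}. v = T_pt K k) \<longleftrightarrow> i < h"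
        unfolding 3(2) T_pt_inj using 3(1) by auto
      ultimately show ?thesis by auto
    next
      case 4
      then show ?thesis using boundary_disjoint(3)[of j] boundary_disjoint(4)[of _ j]
        by (auto simp: B_set_def) metis+
    qed
  qed
  then show ?thesis using T_sink_iff[OF assms] start_pts_iff(3)[OF i] by blast
qed

text \<open>Supplies the hypothesis of \<open>two_colouring\<close>. Only two left or two right side
  vertices could fail to be separated, and \<open>hfpl\<close> forbids paths between them; for two
  vertices of \<open>T\<close>, or two of \<open>B\<close>, the order of the indices
  decides.\<close>

lemma starts_separate:
  assumes "degree f u = 1" "degree f v = 1" "u \<noteq> v" "path_connected f u v"
  shows "(u \<in> start_pts) \<noteq> (v \<in> start_pts)"
proof -
  have LL: "\<not> (u \<in> LB \<union> LT \<and> v \<in> LB \<union> LT)" and RR: "\<not> (u \<in> RB \<union> RT \<and> v \<in> RB \<union> RT)"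
    using hfpl assms unfolding hfpl_def by blast+
  have T: "(u \<in> start_pts) \<noteq> (v \<in> start_pts)"
    if i: "i \<in> {1..L}" "u = T_pt K i" and uv: "degree f v = 1" "u \<noteq> v" "path_connected f u v" for i u v
  proof -
    have du: "degree f u = 1" using i degree_TB by (auto simp: T_set_def)
    have vu: "path_connected f v u" using uv path_connected_sym by blast
    have u: "u \<in> start_pts \<longleftrightarrow> v \<in> RT \<union> RB \<or> (\<exists>h\<in>{i<..L}. v = T_pt K h)"
      using T_start_iff[OF i(1)] i(2) uv by blast
    consider "v \<in> LB \<union> LT" | "v \<in> RB \<union> RT" | h where "h \<in> {1..L}" "v = T_pt K h"
      | j where "j \<in> {1..K + L - N}" "v = B_pt K M N j"
      using degree_1_cases[OF uv(1)] by blast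
    then show ?thesis
    proof cases
      case 1
      then have "v \<notin> RT \<union> RB" "\<And>h. h \<in> {i<..L} \<Longrightarrow> v \<noteq> T_pt K h"
        using boundary_disjoint(1)[of v] boundary_disjoint(2) by (blast, force)
      then show ?thesis using u start_pts_iff(1)[of v] 1 by blast
    next
      case 2
      then show ?thesis using u start_pts_iff(2)[of v] by blast
    next
      case 3
      have v: "v \<in> start_pts \<longleftrightarrow> u \<in> RT \<union> RB \<or> (\<exists>k\<in>{h<..L}. u = T_pt K k)"
        using T_start_iff[OF 3(1) du] 3(2) vu uv by metis
      have "u \<notin> RT \<union> RB" "v \<notin> RT \<union> RB" using boundary_disjoint(2) i 3 by blast+
      moreover have "(\<exists>k\<in>{i<..L}. v = T_pt K k) \<longleftrightarrow> i < h" "(\<exists>k\<in>{h<..L}. u = T_pt K k) \<longleftrightarrow> h < i"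
        unfolding 3(2) i(2) T_pt_inj using 3(1) i(1) by auto
      ultimately have "u \<in> start_pts \<longleftrightarrow> i < h" "v \<in> start_pts \<longleftrightarrow> h < i"
        using u v by blast+
      moreover have "i \<noteq> h" using i 3 uv by blast
      ultimately show ?thesis by auto
    next
      case 4
      have "B_source j"
        using B_source_iff[OF 4(1) du] 4(2) vu uv i by (auto simp: T_set_def)
      then have "v \<in> start_pts" using start_pts_iff(4)[OF 4(1)] 4(2) by blast
      moreover have "u \<notin> start_pts"
        using u 4 boundary_disjoint(3)[OF 4(1)] boundary_disjoint(4) by (metis UnCI UnE)
      ultimately show ?thesis by blast
    qed
  qed
  have B: "(u \<in> start_pts) \<noteq> (v \<in> start_pts)"
    if j: "j \<in> {1..K + L - N}" "u = B_pt K M N j" and uv: "degree f v = 1" "u \<noteq> v" "path_connected f u v"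
      and vT: "\<And>i. i \<in> {1..L} \<Longrightarrow> v \<noteq> T_pt K i" for j u v
  proof -
    have du: "degree f u = 1" using j degree_TB by (auto simp: B_set_def)
    have vu: "path_connected f v u" using uv path_connected_sym by blast
    have nT: "v \<notin> T" using vT unfolding T_set_def by blast
    have u: "u \<in> start_pts \<longleftrightarrow> v \<in> RT \<union> RB \<or> (\<exists>h\<in>{j<..K + L - N}. v = B_pt K M N h)"
      using B_source_iff[OF j(1) uv(1)] uv j nT start_pts_iff(4)[OF j(1)] by blast
    consider "v \<in> LB \<union> LT" | "v \<in> RB \<union> RT" | h where "h \<in> {1..K + L - N}" "v = B_pt K M N h"
      using degree_1_cases[OF uv(1)] vT by blast
    then show ?thesis
    proof cases
      case 1
      then have "v \<notin> RT \<union> RB" "\<And>h. h \<in> {j<..K + L - N} \<Longrightarrow> v \<noteq> B_pt K M N h"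
        using boundary_disjoint(1)[of v] boundary_disjoint(3) by (blast, force)
      then show ?thesis using u start_pts_iff(1)[of v] 1 by blast
    next
      case 2
      then show ?thesis using u start_pts_iff(2)[of v] by blast
    next
      case 3
      have uT: "u \<notin> T" using j boundary_disjoint(4) by (auto simp: T_set_def) metis
      have v: "v \<in> start_pts \<longleftrightarrow> u \<in> RT \<union> RB \<or> (\<exists>k\<in>{h<..K + L - N}. u = B_pt K M N k)"
        using B_source_iff[OF 3(1) du] vu uv(2)[symmetric] uT start_pts_iff(4)[OF 3(1)] unfolding 3(2) by blast
      have "u \<notin> RT \<union> RB" "v \<notin> RT \<union> RB" using boundary_disjoint(3) j 3 by blast+
      moreover have "(\<exists>k\<in>{j<..K + L - N}. v = B_pt K M N k) \<longleftrightarrow> j < h"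
        "(\<exists>k\<in>{h<..K + L - N}. u = B_pt K M N k) \<longleftrightarrow> h < j"
        unfolding 3(2) j(2) B_pt_inj using 3(1) j(1) by auto
      ultimately have "u \<in> start_pts \<longleftrightarrow> j < h" "v \<in> start_pts \<longleftrightarrow> h < j"
        using u v by blast+
      moreover have "j \<noteq> h" using j 3 uv by blast
      ultimately show ?thesis by auto
    qed
  qed
  have vu: "path_connected f v u" using assms path_connected_sym by blast
  show ?thesis
  proof (cases "(\<exists>i\<in>{1..L}. u = T_pt K i) \<or> (\<exists>i\<in>{1..L}. v = T_pt K i)")
    case True
    then show ?thesis using T[of _ u v] T[of _ v u] assms vu by metis
  next
    case noT: False
    show ?thesis
    proof (cases "(\<exists>i\<in>{1..K + L - N}. u = B_pt K M N i) \<or> (\<exists>i\<in>{1..K + L - N}. v = B_pt K M N i)")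
      case True
      then show ?thesis using B[of _ u v] B[of _ v u] assms vu noT by metis
    next
      case False
      then have "u \<in> LB \<union> LT \<and> v \<in> RB \<union> RT \<or> u \<in> RB \<union> RT \<and> v \<in> LB \<union> LT"
        using noT LL RR degree_1_cases[OF assms(1)] degree_1_cases[OF assms(2)] by blast
      then show ?thesis using start_pts_iff(1,2)[of u] start_pts_iff(1,2)[of v] by blast
    qed
  qed
qed

section \<open>Coordinates of the boundary and the two matchings\<close>

lemma side_pts:
  "(x, y) \<in> V \<Longrightarrow> x + y = 2 * (int K + int L) \<Longrightarrow> (x, y) \<in> RT"
  "(x, y) \<in> V \<Longrightarrow> x + y = - 1 \<Longrightarrow> (x, y) \<in> LB"
  "(x, y) \<in> V \<Longrightarrow> x = y \<Longrightarrow> (x, y) \<in> LT"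
  "(x, y) \<in> V \<Longrightarrow> x - y = 2 * (int M + int L) + 1 \<Longrightarrow> (x, y) \<in> RB"
proof -
  show "(x, y) \<in> RT" if "(x, y) \<in> V" "x + y = 2 * (int K + int L)"
    unfolding RT_set_def using that
    by (intro image_eqI[of _ _ "nat (int K - y)"]) (auto simp: hex_verts_def RT_pt_def)
  show "(x, y) \<in> LB" if "(x, y) \<in> V" "x + y = - 1"
    unfolding LB_set_def using that KMN
    by (intro image_eqI[of _ _ "nat (x + 1)"]) (auto simp: hex_verts_def LB_pt_def of_nat_diff)
  show "(x, y) \<in> LT" if "(x, y) \<in> V" "x = y"
    unfolding LT_set_def using that
    by (intro image_eqI[of _ _ "nat (x + 1)"]) (auto simp: hex_verts_def LT_pt_def)
  show "(x, y) \<in> RB" if "(x, y) \<in> V" "x - y = 2 * (int M + int L) + 1"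
    unfolding RB_set_def using that
    by (intro image_eqI[of _ _ "nat (y + int M + int N + 1 - int K)"]) (auto simp: hex_verts_def RB_pt_def)
qed

lemma boundary_coords:
  "(x, y) \<in> LT \<Longrightarrow> x = y" "(x, y) \<in> LB \<Longrightarrow> x + y = - 1"
  "(x, y) \<in> RT \<Longrightarrow> x + y = 2 * (int K + int L)"
  "(x, y) \<in> RB \<Longrightarrow> x - y = 2 * (int M + int L) + 1"
  "(x, y) \<in> T \<Longrightarrow> y = int K - 1" "(x, y) \<in> B \<Longrightarrow> y = int K - int M - int N"
  by (auto simp: LT_set_def LT_pt_def LB_set_def LB_pt_def RT_set_def RT_pt_def RB_set_def RB_pt_def
      T_set_def T_pt_def B_set_def B_pt_def Let_def)

lemma boundary_parity:
  "v \<in> LT \<union> RT \<union> T \<Longrightarrow> even (fst v + snd v)" "v \<in> LB \<union> RB \<union> B \<Longrightarrow> odd (fst v + snd v)"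
proof -
  have "even (fst (T_pt K i) + snd (T_pt K i))" "odd (fst (B_pt K M N j) + snd (B_pt K M N j))" for i j
    unfolding T_pt_sum B_pt_sum by simp_all
  then have T: "v \<in> T \<longrightarrow> even (fst v + snd v)" and B: "v \<in> B \<longrightarrow> odd (fst v + snd v)"
    unfolding T_set_def B_set_def by blast+
  show "even (fst v + snd v)" if "v \<in> LT \<union> RT \<union> T"
    using that T boundary_sums(1,3)[of v] by blast
  show "odd (fst v + snd v)" if "v \<in> LB \<union> RB \<union> B"
    using that B boundary_sums(2,4)[of v] by blast
qed

lemma boundary_conditions:
  "(count_list (word_lT K f) 0 + count_list (word_t K L M N f) 0
      = count_list (word_rB K L M N f) 0 + count_list (word_b K L M N f) 0 \<and>
    count_list (word_t K L M N f) 1 + count_list (word_rT K L M f) 1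
      = count_list (word_b K L M N f) 1 + count_list (word_lB K M N f) 1) \<and>
   (word_le (word_lT K f @ word_t K L M N f) (word_b K L M N f @ word_rB K L M N f) \<and>
    word_le (word_t K L M N f @ word_rT K L M f) (word_lB K M N f @ word_b K L M N f)) \<and>
   inversions (word_rB K L M N f) + inversions (word_b K L M N f) + inversions (word_lB K M N f) \<ge>
     inversions (word_lT K f) + inversions (word_t K L M N f) + inversions (word_rT K L M f)
     + count_list (word_lT K f) 1 * count_list (word_t K L M N f) 0
     + count_list (word_t K L M N f) 1 * count_list (word_rT K L M f) 0
     + count_list (word_rB K L M N f) 0 * count_list (word_lB K M N f) 1"
proof -
  have edge: "\<forall>e\<in>f. \<exists>u v. e = {u, v} \<and> even (fst u + snd u) \<noteq> even (fst v + snd v)"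
    using hex_edges_parity f_subset by blast
  have deg: "\<forall>v. degree f v \<le> 2" using degree_le_2 by blast
  have sep: "\<forall>u v. degree f u = 1 \<longrightarrow> degree f v = 1 \<longrightarrow> u \<noteq> v \<longrightarrow> path_connected f u v \<longrightarrow>
      (u \<in> start_pts) \<noteq> (v \<in> start_pts)"
    using starts_separate by blast
  obtain C :: "bool \<Rightarrow> point set" and \<mu> :: "bool \<Rightarrow> point \<Rightarrow> point"
    where C: "\<forall>c. \<forall>u\<in>C c. {u, \<mu> c u} \<in> f \<and> \<mu> c u \<in> C c \<and> \<mu> c (\<mu> c u) = u"
      "\<forall>u\<in>C True \<inter> C False. \<mu> True u \<noteq> \<mu> False u"
      "\<forall>c u. degree f u = 2 \<longrightarrow> u \<in> C c"
      "\<forall>c u. degree f u = 1 \<longrightarrow> (u \<in> C c \<longleftrightarrow> (even (fst u + snd u) = c) = (u \<in> start_pts))"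
    using two_colouring[OF finite_f edge deg sep] by (elim exE conjE) (rule that)
  have C_edge: "{u, \<mu> c u} \<in> f" and C_inv: "\<mu> c u \<in> C c \<and> \<mu> c (\<mu> c u) = u" if "u \<in> C c" for c u
    using C(1) that by blast+
  have C_disj: "\<mu> True u \<noteq> \<mu> False u" if "u \<in> C True" "u \<in> C False" for u
    using C(2) that by blast
  have C_2: "u \<in> C c" if "degree f u = 2" for c u using C(3) that by blast
  have C_1: "u \<in> C c \<longleftrightarrow> (even (fst u + snd u) = c) = (u \<in> start_pts)" if "degree f u = 1" for c u
    using C(4) that by blast
  have C_V: "u \<in> V" if "u \<in> C c" for c u using edge_V[OF C_edge[OF that]] .
  have C_adj: "(fst u - fst (\<mu> c u))\<^sup>2 + (snd u - snd (\<mu> c u))\<^sup>2 = 1" if "u \<in> C c" for c u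
    by (rule hex_edgesD(2)[OF subsetD[OF f_subset C_edge[OF that]]])
  \<comment> \<open>A side vertex of degree 0 lies in neither colour class.\<close>
  have C_side: "u \<in> C c \<longleftrightarrow> degree f u = 1 \<and> (even (fst u + snd u) = c) = (u \<in> start_pts)"
    if "u \<in> LT \<union> LB \<union> RT \<union> RB" for c u
  proof (cases "degree f u = 1")
    case True
    then show ?thesis using C_1 by blast
  next
    case False
    then have "degree f u = 0" using degree_sides[of u] that by blast
    then have "u \<notin> C c" using C_edge degree_pos_iff[OF finite_f, of u] by (metis insertI1 less_irrefl)
    then show ?thesis using False by blast
  qed
  \<comment> \<open>Blue covers odd starts and even ends, red covers even starts and odd ends. Hence
    \<open>LT\<close> and \<open>RB\<close> can meet only blue edges, \<open>LB\<close> and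
    \<open>RT\<close> only red ones.\<close>
  have LT: "u \<in> C c \<longleftrightarrow> c \<and> degree f u = 1" if "u \<in> LT" for c u
    using C_side[of u c] start_pts_iff(1)[of u] boundary_parity(1)[of u] that by blast
  have LB: "u \<in> C c \<longleftrightarrow> \<not> c \<and> degree f u = 1" if "u \<in> LB" for c u
    using C_side[of u c] start_pts_iff(1)[of u] boundary_parity(2)[of u] that by blast
  have RT: "u \<in> C c \<longleftrightarrow> \<not> c \<and> degree f u = 1" if "u \<in> RT" for c u
    using C_side[of u c] start_pts_iff(2)[of u] boundary_parity(1)[of u] that by blast
  have RB: "u \<in> C c \<longleftrightarrow> c \<and> degree f u = 1" if "u \<in> RB" for c u
    using C_side[of u c] start_pts_iff(2)[of u] boundary_parity(2)[of u] that by blast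
  have T: "T_pt K i \<in> C c \<longleftrightarrow> c = (\<not> T_sink i)" if "i \<in> {1..L}" for c i
  proof -
    have t: "T_pt K i \<in> T" using that by (auto simp: T_set_def)
    then show ?thesis
      using C_1[OF degree_TB, of "T_pt K i" c] start_pts_iff(3)[OF that] boundary_parity(1)[of "T_pt K i"]
      by blast
  qed
  have B: "B_pt K M N i \<in> C c \<longleftrightarrow> c = (\<not> B_source i)" if "i \<in> {1..K + L - N}" for c i
  proof -
    have t: "B_pt K M N i \<in> B" using that by (auto simp: B_set_def)
    then show ?thesis
      using C_1[OF degree_TB, of "B_pt K M N i" c] start_pts_iff(4)[OF that] boundary_parity(2)[of "B_pt K M N i"]
      by blast
  qed
  have uncovered: "v \<in> LB \<union> LT \<union> RB \<union> RT \<union> T \<union> B" if "v \<in> V" "v \<notin> C c" for v c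
    using degree_inner C_2 that by blast
  have odd_unc: "v \<in> LT \<union> RT \<union> T" if "v \<in> V" "v \<notin> C c" "even (fst v + snd v)" for v c
    using uncovered[OF that(1,2)] boundary_parity(2)[of v] that(3) by blast
  have even_unc: "v \<in> LB \<union> RB \<union> B" if "v \<in> V" "v \<notin> C c" "odd (fst v + snd v)" for v c
    using uncovered[OF that(1,2)] boundary_parity(1)[of v] that(3) by blast
  define \<rho> :: "point \<Rightarrow> point" where "\<rho> v = (fst v, - 1 - snd v)" for v
  have \<rho>\<rho>: "\<rho> (\<rho> v) = v" for v by (simp add: \<rho>_def)
  have \<rho>_V: "(x, y) \<in> hex_verts (M + N - K) (K + L - N) N M \<longleftrightarrow> \<rho> (x, y) \<in> V" for x y
    using KMN NKL by (auto simp: hex_verts_def \<rho>_def of_nat_diff)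
  have \<rho>_par: "even (fst (\<rho> v) + snd (\<rho> v)) \<longleftrightarrow> odd (fst v + snd v)" for v
    unfolding \<rho>_def fst_conv snd_conv by presburger
  \<comment> \<open>After reflection \<open>RB\<close> and \<open>LT\<close>, which red avoids, take
    over the roles of \<open>RT\<close> and \<open>LB\<close>.\<close>
  interpret P: hex_matching_pair K L M N "C True" "\<mu> True" "{v. \<rho> v \<in> C False}" "\<lambda>v. \<rho> (\<mu> False (\<rho> v))"
  proof (intro hex_matching_pair.intro hex_matching.intro hex_matching_pair_axioms.intro)
    show "K \<le> M + N" "N \<le> K + L" "1 \<le> M + N" by (fact KMN NKL MN)+
    show "M + N - K \<le> N + M" "M \<le> M + N - K + (K + L - N)" "1 \<le> N + M"
      using KMN NKL MN by auto
    show "C True \<subseteq> V" using C_V by blast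
    show "{v. \<rho> v \<in> C False} \<subseteq> hex_verts (M + N - K) (K + L - N) N M"
    proof
      fix v assume "v \<in> {v. \<rho> v \<in> C False}"
      then show "v \<in> hex_verts (M + N - K) (K + L - N) N M"
        using C_V \<rho>_V[of "fst v" "snd v"] by auto
    qed
    show "\<mu> True v \<in> C True" "\<mu> True (\<mu> True v) = v"
      "(fst v - fst (\<mu> True v))\<^sup>2 + (snd v - snd (\<mu> True v))\<^sup>2 = 1" if "v \<in> C True" for v
      using that C_inv C_adj by blast+
    fix v assume v: "v \<in> {v. \<rho> v \<in> C False}"
    show "\<rho> (\<mu> False (\<rho> v)) \<in> {v. \<rho> v \<in> C False}" "\<rho> (\<mu> False (\<rho> (\<rho> (\<mu> False (\<rho> v))))) = v"
      using v C_inv by (auto simp: \<rho>\<rho>)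
    show "(fst v - fst (\<rho> (\<mu> False (\<rho> v))))\<^sup>2 + (snd v - snd (\<rho> (\<mu> False (\<rho> v))))\<^sup>2 = 1"
      using v C_adj[of "\<rho> v" False] by (simp add: \<rho>_def power2_eq_square algebra_simps)
  next
    fix x y :: int assume "x + y = 2 * (int K + int L)"
    then show "(x, y) \<notin> C True" using side_pts(1)[of x y] RT[of "(x, y)" True] C_V by blast
  next
    fix x y :: int assume "x + y = - 1"
    then show "(x, y) \<notin> C True" using side_pts(2)[of x y] LB[of "(x, y)" True] C_V by blast
  next
    fix x y :: int assume *: "(x, y) \<in> V" "even (x + y)" "(x, y) \<notin> C True"
    then have "(x, y) \<in> LT \<union> RT \<union> T" using odd_unc[of "(x, y)" True] by simp
    then show "x + y = 2 * (int K + int L) \<or> x = y \<or> y = int K - 1"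
      using boundary_coords by blast
  next
    fix x y :: int assume *: "(x, y) \<in> V" "odd (x + y)" "(x, y) \<notin> C True"
    then have "(x, y) \<in> LB \<union> RB \<union> B" using even_unc[of "(x, y)" True] by simp
    then show "x + y = - 1 \<or> y = int K - int M - int N \<or> x - y = 2 * (int M + int L) + 1"
      using boundary_coords by blast
  next
    fix x y :: int assume "x + y = 2 * (int (M + N - K) + int (K + L - N))"
    then have "x - (- 1 - y) = 2 * (int M + int L) + 1" using KMN NKL by (simp add: of_nat_diff)
    then show "(x, y) \<notin> {v. \<rho> v \<in> C False}"
      using side_pts(4)[of x "- 1 - y"] RB[of "(x, - 1 - y)" False] C_V by (auto simp: \<rho>_def)
  next
    fix x y :: int assume "x + y = - 1"
    then have "x = - 1 - y" by simp
    then show "(x, y) \<notin> {v. \<rho> v \<in> C False}"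
      using side_pts(3)[of x "- 1 - y"] LT[of "(x, - 1 - y)" False] C_V by (auto simp: \<rho>_def)
  next
    fix x y :: int
    assume *: "(x, y) \<in> hex_verts (M + N - K) (K + L - N) N M" "even (x + y)" "(x, y) \<notin> {v. \<rho> v \<in> C False}"
    have "(x, - 1 - y) \<in> LB \<union> RB \<union> B"
      using even_unc[of "\<rho> (x, y)" False] * \<rho>_V[of x y] \<rho>_par[of "(x, y)"] by (simp add: \<rho>_def)
    then have "x + (- 1 - y) = - 1 \<or> - 1 - y = int K - int M - int N \<or> x - (- 1 - y) = 2 * (int M + int L) + 1"
      using boundary_coords by blast
    then show "x + y = 2 * (int (M + N - K) + int (K + L - N)) \<or> x = y \<or> y = int (M + N - K) - 1"
      using KMN NKL by (auto simp: of_nat_diff)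
  next
    fix x y :: int
    assume *: "(x, y) \<in> hex_verts (M + N - K) (K + L - N) N M" "odd (x + y)" "(x, y) \<notin> {v. \<rho> v \<in> C False}"
    have "(x, - 1 - y) \<in> LT \<union> RT \<union> T"
      using odd_unc[of "\<rho> (x, y)" False] * \<rho>_V[of x y] \<rho>_par[of "(x, y)"] by (simp add: \<rho>_def)
    then have "x = - 1 - y \<or> x + (- 1 - y) = 2 * (int K + int L) \<or> - 1 - y = int K - 1"
      using boundary_coords by blast
    then show "x + y = - 1 \<or> y = int (M + N - K) - int N - int M \<or> x - y = 2 * (int N + int (K + L - N)) + 1"
      using KMN NKL by (auto simp: of_nat_diff)
  next
    fix x y x' y' :: int
    assume "(x, y) \<in> C True" "\<mu> True (x, y) = (x', y')" "(x, - 1 - y) \<in> {v. \<rho> v \<in> C False}"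
    then show "\<rho> (\<mu> False (\<rho> (x, - 1 - y))) \<noteq> (x', - 1 - y')"
      using C_disj[of "(x, y)"] by (auto simp: \<rho>_def prod_eq_iff)
  qed
  let ?lT = "word_lT K f" and ?t = "word_t K L M N f" and ?rT = "word_rT K L M f"
    and ?rB = "word_rB K L M N f" and ?b = "word_b K L M N f" and ?lB = "word_lB K M N f"
  have len: "length ?lT = K" "length ?t = L" "length ?rT = M" "length ?rB = N" "length ?b = K + L - N"
    "length ?lB = M + N - K"
    by (simp_all add: word_lT_def word_t_def word_rT_def word_rB_def word_b_def word_lB_def del: upt_Suc)
  have nth_lT: "i < K \<Longrightarrow> ?lT ! i = 1 \<longleftrightarrow> LT_pt (Suc i) \<in> C True" for i
    using LT[of "LT_pt (Suc i)" True] by (auto simp: word_lT_def LT_set_def simp del: upt_Suc)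
  have nth_lB: "i < M + N - K \<Longrightarrow> ?lB ! i = 1 \<longleftrightarrow> LB_pt (Suc i) \<notin> C False" for i
    using LB[of "LB_pt (Suc i)" False] by (auto simp: word_lB_def LB_set_def simp del: upt_Suc)
  have nth_rT: "i < M \<Longrightarrow> ?rT ! i = 1 \<longleftrightarrow> RT_pt K L (Suc i) \<notin> C False" for i
    using RT[of "RT_pt K L (Suc i)" False] by (auto simp: word_rT_def RT_set_def simp del: upt_Suc)
  have nth_rB: "i < N \<Longrightarrow> ?rB ! i = 1 \<longleftrightarrow> RB_pt K L M N (Suc i) \<in> C True" for i
    using RB[of "RB_pt K L M N (Suc i)" True] by (auto simp: word_rB_def RB_set_def simp del: upt_Suc)
  \<comment> \<open>A vertex of \<open>T\<close> is covered by exactly one colour; letter 1 means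
    blue. Stating this for both \<open>c\<close> serves blue sources and red sinks alike.\<close>
  have nth_t: "?t ! i = 1 \<longleftrightarrow> (T_pt K (Suc i) \<in> C c) = c" if "i < L" for i c
    using T[of "Suc i" c] that by (auto simp: word_t_def T_sink_def simp del: upt_Suc)
  have nth_b: "?b ! i = 1 \<longleftrightarrow> (B_pt K M N (Suc i) \<in> C c) = c" if "i < K + L - N" for i c
    using B[of "Suc i" c] that by (auto simp: word_b_def B_source_def simp del: upt_Suc)
  show ?thesis
  proof (rule P.boundary_words[OF len])
    show "P.A.sources = zeros (?lT @ ?t)"
    proof -
      have "P.A.source_pt i \<in> C True \<longleftrightarrow> (?lT @ ?t) ! i = 1" if i: "i < K + L" for i
      proof (cases "i < K")
        case True
        then have "P.A.source_pt i = LT_pt (Suc i)" by (simp add: P.A.source_pt_def LT_pt_def)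
        then show ?thesis using True nth_lT by (simp add: nth_append len)
      next
        case False
        then have "P.A.source_pt i = T_pt K (Suc (i - K))"
          by (simp add: P.A.source_pt_def T_pt_def of_nat_diff)
        then show ?thesis using False nth_t[of "i - K" True] i by (simp add: nth_append len)
      qed
      then show ?thesis by (auto simp: P.A.sources_def zeros_def len)
    qed
    show "P.A.sinks = zeros (?b @ ?rB)"
    proof -
      have "P.A.sink_pt i \<in> C True \<longleftrightarrow> (?b @ ?rB) ! i = 1" if i: "i < K + L" for i
      proof (cases "i < K + L - N")
        case True
        then have "P.A.sink_pt i = B_pt K M N (Suc i)" by (simp add: P.A.sink_pt_def B_pt_def Let_def)
        then show ?thesis using True nth_b[of i True] by (simp add: nth_append len)
      next
        case False
        then have "P.A.sink_pt i = RB_pt K L M N (Suc (i - (K + L - N)))"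
          using NKL by (simp add: P.A.sink_pt_def RB_pt_def of_nat_diff)
        moreover have "i - (K + L - N) < N" using False i NKL by linarith
        ultimately show ?thesis using False nth_rB by (simp add: nth_append len)
      qed
      then show ?thesis using NKL by (auto simp: P.A.sinks_def zeros_def len)
    qed
    show "P.B.sources = ones (?lB @ ?b)"
    proof -
      have "\<rho> (P.B.source_pt i) \<in> C False \<longleftrightarrow> (?lB @ ?b) ! i \<noteq> 1" if i: "i < M + N - K + (K + L - N)" for i
      proof (cases "i < M + N - K")
        case True
        then have "\<rho> (P.B.source_pt i) = LB_pt (Suc i)" by (simp add: P.B.source_pt_def LB_pt_def \<rho>_def)
        then show ?thesis using True nth_lB by (simp add: nth_append len)
      next
        case False
        then have "\<rho> (P.B.source_pt i) = B_pt K M N (Suc (i - (M + N - K)))"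
          using KMN by (simp add: P.B.source_pt_def B_pt_def \<rho>_def Let_def of_nat_diff)
        moreover have "i - (M + N - K) < K + L - N" using False i by linarith
        ultimately show ?thesis using False nth_b[of "i - (M + N - K)" False] by (simp add: nth_append len)
      qed
      then show ?thesis by (auto simp: P.B.sources_def ones_def len)
    qed
    show "P.B.sinks = ones (?t @ ?rT)"
    proof -
      have L: "M + N - K + (K + L - N) - M = L" "M + N - K + (K + L - N) = L + M" using KMN NKL by auto
      have "\<rho> (P.B.sink_pt i) \<in> C False \<longleftrightarrow> (?t @ ?rT) ! i \<noteq> 1" if i: "i < L + M" for i
      proof (cases "i < L")
        case True
        then have "\<rho> (P.B.sink_pt i) = T_pt K (Suc i)"
          using KMN NKL by (simp add: P.B.sink_pt_def T_pt_def \<rho>_def L of_nat_diff)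
        then show ?thesis using True nth_t[of i False] by (simp add: nth_append len)
      next
        case False
        then have "\<rho> (P.B.sink_pt i) = RT_pt K L (Suc (i - L))"
          using KMN NKL by (simp add: P.B.sink_pt_def RT_pt_def \<rho>_def L of_nat_diff)
        moreover have "i - L < M" using False i by linarith
        ultimately show ?thesis using False nth_rT by (simp add: nth_append len)
      qed
      then show ?thesis by (auto simp: P.B.sinks_def ones_def len L)
    qed
  qed
qed

end

text \<open>Covers \<open>M + N = 0\<close>, which \<open>hfpl_configuration\<close> excludes. The
  hexagon is then empty, since \<open>0 \<le> y \<le> - 1\<close> is impossible, yet the
  \<open>L\<close> points of the top row are required to have degree 1.\<close>

lemma hfpl_empty:
  assumes "hfpl 0 L 0 0 f" shows "L = 0"
proof (rule ccontr)
  assume "L \<noteq> 0"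
  then have "T_pt 0 1 \<in> T_set 0 L" by (auto simp: T_set_def)
  then have "degree f (T_pt 0 1) = 1" using assms unfolding hfpl_def by blast
  moreover have "f = {}" using assms by (auto simp: hfpl_def hex_edges_def hex_verts_def)
  ultimately show False by (simp add: degree_def)
qed

theorem corollary2p8:
  fixes K L M N :: nat
    and lT t rT rB b lB :: "bit list"
  assumes "K \<le> M + N" and "N \<le> K + L"
    and "length lT = K" and "length t = L" and "length rT = M"
    and "length rB = N" and "length b = K + L - N" and "length lB = M + N - K"
    and "\<exists>f. hfpl K L M N f \<and> hfpl_boundary K L M N f = (lT, t, rT, rB, b, lB)"
  shows "(count_list lT 0 + count_list t 0 = count_list rB 0 + count_list b 0 \<and>
          count_list t 1 + count_list rT 1 = count_list b 1 + count_list lB 1) \<and>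
         (word_le (lT @ t) (b @ rB) \<and> word_le (t @ rT) (lB @ b)) \<and>
         inversions rB + inversions b + inversions lB \<ge>
           inversions lT + inversions t + inversions rT
           + count_list lT 1 * count_list t 0 + count_list t 1 * count_list rT 0
           + count_list rB 0 * count_list lB 1"
proof -
  obtain f where f: "hfpl K L M N f" "hfpl_boundary K L M N f = (lT, t, rT, rB, b, lB)"
    using assms(9) by blast
  show ?thesis
  proof (cases "M + N = 0")
    case True
    then have "L = 0" using hfpl_empty f(1) assms(1) by simp
    then show ?thesis using True assms by (simp add: word_le_def)
  next
    case False
    then interpret hfpl_configuration K L M N f
      by unfold_locales (use assms(1,2) f(1) False in auto)
    show ?thesis using boundary_conditions f(2) by (auto simp: hfpl_boundary_def)
  qed
qed

end
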